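(* (1) Let $X$ be a topological space and $Y\subseteq X$ a subset with the subspace topology. Then $\mathrm{Top}(Y)$ is canonically isomorphic to $\overline{Q(\mathrm{Top}(X),\mathfrak{P}_Y)}$. (2) Let $R$ be a commutative ring and $\mathfrak{p}$ a prime ideal of $R$. Let $Y(\mathfrak{p})=\{\mathfrak{q}\in\mathrm{Spec}(R)\mid\mathfrak{q}\subset\mathfrak{p}\}$. Then $\mathrm{Top}(\mathrm{Spec}(R_{\mathfrak{p}}))$ is canonically isomorphic to $\overline{Q(\mathrm{Top}(\mathrm{Spec}(R)),\mathfrak{P}_{Y(\mathfrak{p})})}$.
   Context: For a topological space $X$, $\mathrm{Top}(X)$ is the category whose objects are the open subsets of $X$ and whose morphisms are the inclusions. $\mathrm{Spec}$ carries the Zariski topology. Path structure. Put $C=\mathrm{Top}(X)$. Let $\Gamma$ be the set of functions $\gamma:[0,1]\to\mathrm{Ob}(C)$ obtained as follows: for some $n\ge1$, a partition of $[0,1]$ into subintervals $I_0,\dots,I_n$ listed in increasing order, and open sets $U_0\subseteq U_1\subseteq\cdots\subseteq U_n$, put $\gamma(t)=U_i$ for $t\in I_i$. Put $\gamma\sim\gamma'$ iff $\gamma(0)=\gamma'(0)$ and $\gamma(1)=\gamma'(1)$, and write $[\gamma]$ for the class. Then $C$ is the category with objects $\mathrm{Ob}(C)$, morphisms $U\to V$ the classes $[\gamma]$ with $\gamma(0)=U$, $\gamma(1)=V$, and composition by concatenation. The partition $\mathfrak{P}_Y$. For $Y\subseteq X$ and $Z\subseteq Y$ let $A_Z=\{U\in\mathrm{Ob}(C)\mid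 U\cap Y=Z\}$. Then $\mathfrak{P}_Y$ is the partition of $\mathrm{Ob}(C)$ into the nonempty sets $A_Z$; its elements are called pixels. Pixelation. $\Sigma_{\mathfrak{P}_Y}$ is the class of morphisms $[\rho]$ of $C$ with $\mathrm{im}(\rho)$ contained in one pixel; it admits a two-sided calculus of fractions, giving $C[\Sigma_{\mathfrak{P}_Y}^{-1}]$. Choose an object $s_{\mathsf{X}}$ in each pixel $\mathsf{X}$. A pseudo arrow is a morphism $[\rho]^{-1}[\gamma]$ of $C[\Sigma_{\mathfrak{P}_Y}^{-1}]$ with $[\rho]\in\Sigma_{\mathfrak{P}_Y}$ such that $[0,1]$ can be partitioned into exactly two subintervals which $\gamma$ maps into two distinct pixels respectively. $Q(C,\mathfrak{P}_Y)$ is the quiver with vertices the pixels and arrows $\mathsf{X}\to\mathsf{X}'$ the pseudo arrows $s_{\mathsf{X}}\to s_{\mathsf{X}'}$ (at most one). Let $\Psi$ be the functor from the free category on this quiver to $C[\Sigma_{\mathfrak{P}_Y}^{-1}]$ given by $\mathsf{X}\mapsto s_{\mathsf{X}}$ and sending each arrow to its pseudo arrow; $\overline{Q(C,\mathfrak{P}_Y)}$ is the quotient of the free category identifying parallel morphisms $f,g$ with $\Psi(f)=\Psi(g)$. (It is a skeleton of $C[\Sigma_{\mathfrak{P}_Y}^{-1}]$.) "Canonically isomorphic" means isomorphic as categories via the assignment $A_Z\leftrightarrow Z$ on objects; in (2) this is combined with the canonical homeomorphism $\mathrm{Spec}(R_{\mathfrak{p}})\cong Y(\mathfrak{p})$.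 *)

theory Defs
  imports
    "HOL-Analysis.Analysis"
    "HOL-Algebra.Ideal"
    "Graph_Theory.Arc_Walk"
begin

section \<open>Categories\<close>

text \<open>\<open>Comp C g f\<close> is \<open>g \<circ> f\<close>, i.e. first \<open>f\<close>, then \<open>g\<close>.\<close>

record ('o, 'm) cat =
  Ob :: "'o set"
  Ar :: "'m set"
  Dom :: "'m \<Rightarrow> 'o"
  Cod :: "'m \<Rightarrow> 'o"
  Ident :: "'o \<Rightarrow> 'm"
  Comp :: "'m \<Rightarrow> 'm \<Rightarrow> 'm"

locale category =
  fixes C :: "('o, 'm) cat"
  assumes Dom_in: "f \<in> Ar C \<Longrightarrow> Dom C f \<in> Ob C"
    and Cod_in: "f \<in> Ar C \<Longrightarrow> Cod C f \<in> Ob C"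
    and Ident_in: "x \<in> Ob C \<Longrightarrow> Ident C x \<in> Ar C"
    and Dom_Ident: "x \<in> Ob C \<Longrightarrow> Dom C (Ident C x) = x"
    and Cod_Ident: "x \<in> Ob C \<Longrightarrow> Cod C (Ident C x) = x"
    and Comp_in: "\<lbrakk>f \<in> Ar C; g \<in> Ar C; Cod C f = Dom C g\<rbrakk> \<Longrightarrow> Comp C g f \<in> Ar C"
    and Dom_Comp: "\<lbrakk>f \<in> Ar C; g \<in> Ar C; Cod C f = Dom C g\<rbrakk> \<Longrightarrow> Dom C (Comp C g f) = Dom C f"
    and Cod_Comp: "\<lbrakk>f \<in> Ar C; g \<in> Ar C; Cod C f = Dom C g\<rbrakk> \<Longrightarrow> Cod C (Comp C g f) = Cod C g"
    and Comp_Ident_right: "f \<in> Ar C \<Longrightarrow> Comp C f (Ident C (Dom C f)) = f"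
    and Comp_Ident_left: "f \<in> Ar C \<Longrightarrow> Comp C (Ident C (Cod C f)) f = f"
    and Comp_assoc: "\<lbrakk>f \<in> Ar C; g \<in> Ar C; h \<in> Ar C; Cod C f = Dom C g; Cod C g = Dom C h\<rbrakk>
      \<Longrightarrow> Comp C h (Comp C g f) = Comp C (Comp C h g) f"

locale category_functor = C: category C + D: category D
  for C :: "('o, 'm) cat" and D :: "('p, 'n) cat" +
  fixes Fo :: "'o \<Rightarrow> 'p" and Fa :: "'m \<Rightarrow> 'n"
  assumes Fo_in: "x \<in> Ob C \<Longrightarrow> Fo x \<in> Ob D"
    and Fa_in: "f \<in> Ar C \<Longrightarrow> Fa f \<in> Ar D"
    and Dom_Fa: "f \<in> Ar C \<Longrightarrow> Dom D (Fa f) = Fo (Dom C f)"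
    and Cod_Fa: "f \<in> Ar C \<Longrightarrow> Cod D (Fa f) = Fo (Cod C f)"
    and Fa_Ident: "x \<in> Ob C \<Longrightarrow> Fa (Ident C x) = Ident D (Fo x)"
    and Fa_Comp: "\<lbrakk>f \<in> Ar C; g \<in> Ar C; Cod C f = Dom C g\<rbrakk>
      \<Longrightarrow> Fa (Comp C g f) = Comp D (Fa g) (Fa f)"

locale category_iso = category_functor +
  assumes bij_Fo: "bij_betw Fo (Ob C) (Ob D)"
    and bij_Fa: "bij_betw Fa (Ar C) (Ar D)"

subsection \<open>Quotients\<close>

text \<open>
  Equivalence classes of arrows are sets of arrows; \<open>Dom\<close>, \<open>Cod\<close> and \<open>Comp\<close> are computed from
  all representatives. In \<open>quotient_cat\<close>, \<open>r\<close> is meant to be an equivalence relation between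
  parallel arrows that is compatible with composition.
\<close>

definition quotient_cat :: "('o, 'm) cat \<Rightarrow> ('m \<times> 'm) set \<Rightarrow> ('o, 'm set) cat" where
  "quotient_cat C r =
    \<lparr>Ob = Ob C,
     Ar = Ar C // r,
     Dom = (\<lambda>c. the_elem (Dom C ` c)),
     Cod = (\<lambda>c. the_elem (Cod C ` c)),
     Ident = (\<lambda>x. r `` {Ident C x}),
     Comp = (\<lambda>d c. \<Union>f\<in>c. \<Union>g\<in>d. r `` {Comp C g f})\<rparr>"

subsection \<open>Categories of fractions\<close>

text \<open>
  A pair \<open>(f, s)\<close> with \<open>s \<in> S\<close> and common codomain is the formal fraction \<open>s\<^sup>-\<^sup>1 f\<close>. Fractions are
  identified by expanding them to a common denominator, and composed by completing
  \<open>Cod s \<leftarrow> Dom s = Dom g \<rightarrow> Cod g\<close> to a commutative square; all completions are allowed, and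
  under a calculus of fractions they give the same class.
\<close>

definition fractions :: "('o, 'm) cat \<Rightarrow> 'm set \<Rightarrow> ('m \<times> 'm) set" where
  "fractions C S = {(f, s). f \<in> Ar C \<and> s \<in> Ar C \<and> s \<in> S \<and> Cod C f = Cod C s}"

definition fraction_rel :: "('o, 'm) cat \<Rightarrow> 'm set \<Rightarrow> (('m \<times> 'm) \<times> ('m \<times> 'm)) set" where
  "fraction_rel C S =
    {((f, s), (g, t)). (f, s) \<in> fractions C S \<and> (g, t) \<in> fractions C S \<and>
       Dom C f = Dom C g \<and> Dom C s = Dom C t \<and>
       (\<exists>u\<in>Ar C. \<exists>v\<in>Ar C. Dom C u = Cod C f \<and> Dom C v = Cod C g \<and> Cod C u = Cod C v \<and>
          Comp C u f = Comp C v g \<and> Comp C u s = Comp C v t \<and> Comp C u s \<in> S)}"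

definition fraction_class :: "('o, 'm) cat \<Rightarrow> 'm set \<Rightarrow> 'm \<Rightarrow> 'm \<Rightarrow> ('m \<times> 'm) set" where
  "fraction_class C S s f = fraction_rel C S `` {(f, s)}"

definition fraction_cat :: "('o, 'm) cat \<Rightarrow> 'm set \<Rightarrow> ('o, ('m \<times> 'm) set) cat" where
  "fraction_cat C S =
    \<lparr>Ob = Ob C,
     Ar = fractions C S // fraction_rel C S,
     Dom = (\<lambda>c. the_elem ((\<lambda>(f, s). Dom C f) ` c)),
     Cod = (\<lambda>c. the_elem ((\<lambda>(f, s). Dom C s) ` c)),
     Ident = (\<lambda>x. fraction_class C S (Ident C x) (Ident C x)),
     Comp = (\<lambda>d c. \<Union>{fraction_class C S (Comp C s' t) (Comp C g' f) | f s g t g' s'.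
        (f, s) \<in> c \<and> (g, t) \<in> d \<and> g' \<in> Ar C \<and> s' \<in> Ar C \<and> s' \<in> S \<and>
        Dom C g' = Cod C s \<and> Dom C s' = Cod C g \<and> Cod C g' = Cod C s' \<and>
        Comp C g' s = Comp C s' g})\<rparr>"

subsection \<open>Free categories\<close>

text \<open>A quiver is a \<^typ>\<open>('v, 'e) pre_digraph\<close>, and its paths are the arc walks of that library.\<close>

definition free_cat :: "('v, 'e) pre_digraph \<Rightarrow> ('v, 'v \<times> 'e list \<times> 'v) cat" where
  "free_cat G =
    \<lparr>Ob = verts G,
     Ar = {(u, p, v). pre_digraph.awalk G u p v},
     Dom = (\<lambda>(u, p, v). u),
     Cod = (\<lambda>(u, p, v). v),
     Ident = (\<lambda>v. (v, [], v)),
     Comp = (\<lambda>(_, q, w) (u, p, _). (u, p @ q, w))\<rparr>"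

primrec compose_list :: "('o, 'm) cat \<Rightarrow> 'o \<Rightarrow> 'm list \<Rightarrow> 'm" where
  "compose_list C x [] = Ident C x"
| "compose_list C x (m # ms) = Comp C (compose_list C (Cod C m) ms) m"

text \<open>
  The arrow part of the functor on \<open>free_cat G\<close> that extends \<open>Fo\<close> on vertices and \<open>Fe\<close> on arcs.
\<close>

definition free_extension ::
  "('o, 'm) cat \<Rightarrow> ('v \<Rightarrow> 'o) \<Rightarrow> ('e \<Rightarrow> 'm) \<Rightarrow> 'v \<times> 'e list \<times> 'v \<Rightarrow> 'm" where
  "free_extension C Fo Fe = (\<lambda>(u, p, v). compose_list C (Fo u) (map Fe p))"

section \<open>Open sets of a topological space\<close>

definition top_cat :: "'a topology \<Rightarrow> ('a set, 'a set \<times> 'a set) cat" where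
  "top_cat X =
    \<lparr>Ob = {U. openin X U},
     Ar = {(U, V). openin X U \<and> openin X V \<and> U \<subseteq> V},
     Dom = fst,
     Cod = snd,
     Ident = (\<lambda>U. (U, U)),
     Comp = (\<lambda>(_, W) (U, _). (U, W))\<rparr>"

subsection \<open>Path structure\<close>

text \<open>
  Partition of \<open>[0,1]\<close> into the subintervals \<open>I 0, \<dots>, I n\<close> in increasing order. The subintervals
  may be open, closed, half-open or single points.
\<close>

definition interval_partition :: "nat \<Rightarrow> (nat \<Rightarrow> real set) \<Rightarrow> bool" where
  "interval_partition n I \<longleftrightarrow>
     (\<forall>i\<le>n. I i \<noteq> {} \<and> is_interval (I i)) \<and>
     (\<Union>i\<le>n. I i) = {0..1} \<and>
     (\<forall>i j. i < j \<and> j \<le> n \<longrightarrow> (\<forall>s\<in>I i. \<forall>t\<in>I j. s < t))"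

text \<open>Functions with domain \<open>[0,1]\<close> are represented as extensional functions.\<close>

definition path_set :: "'a topology \<Rightarrow> (real \<Rightarrow> 'a set) set" where
  "path_set X =
    {\<gamma> \<in> extensional {0..1}. \<exists>n\<ge>1. \<exists>I U. interval_partition n I \<and>
       (\<forall>i\<le>n. openin X (U i)) \<and> (\<forall>i<n. U i \<subseteq> U (Suc i)) \<and>
       (\<forall>i\<le>n. \<forall>t\<in>I i. \<gamma> t = U i)}"

definition path_rel :: "'a topology \<Rightarrow> ((real \<Rightarrow> 'a set) \<times> (real \<Rightarrow> 'a set)) set" where
  "path_rel X = {(\<gamma>, \<delta>). \<gamma> \<in> path_set X \<and> \<delta> \<in> path_set X \<and> \<gamma> 0 = \<delta> 0 \<and> \<gamma> 1 = \<delta> 1}"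

definition path_class :: "'a topology \<Rightarrow> (real \<Rightarrow> 'a set) \<Rightarrow> (real \<Rightarrow> 'a set) set" where
  "path_class X \<gamma> = path_rel X `` {\<gamma>}"

definition path_concat :: "(real \<Rightarrow> 'a set) \<Rightarrow> (real \<Rightarrow> 'a set) \<Rightarrow> real \<Rightarrow> 'a set" where
  "path_concat \<gamma> \<delta> = (\<lambda>t\<in>{0..1}. if t \<le> 1/2 then \<gamma> (2 * t) else \<delta> (2 * t - 1))"

definition path_cat :: "'a topology \<Rightarrow> ('a set, (real \<Rightarrow> 'a set) set) cat" where
  "path_cat X =
    \<lparr>Ob = {U. openin X U},
     Ar = path_set X // path_rel X,
     Dom = (\<lambda>c. the_elem ((\<lambda>\<gamma>. \<gamma> 0) ` c)),
     Cod = (\<lambda>c. the_elem ((\<lambda>\<gamma>. \<gamma> 1) ` c)),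
     Ident = (\<lambda>U. path_class X (\<lambda>t\<in>{0..1}. U)),
     Comp = (\<lambda>d c. \<Union>\<gamma>\<in>c. \<Union>\<delta>\<in>d. path_class X (path_concat \<gamma> \<delta>))\<rparr>"

subsection \<open>Pixelation\<close>

definition pixel :: "'a topology \<Rightarrow> 'a set \<Rightarrow> 'a set \<Rightarrow> 'a set set" where
  "pixel X Y Z = {U. openin X U \<and> U \<inter> Y = Z}"

definition pixels :: "'a topology \<Rightarrow> 'a set \<Rightarrow> 'a set set set" where
  "pixels X Y = {pixel X Y Z | Z. Z \<subseteq> Y} - {{}}"

definition pixel_arrows :: "'a topology \<Rightarrow> 'a set \<Rightarrow> (real \<Rightarrow> 'a set) set set" where
  "pixel_arrows X Y =
    {c \<in> Ar (path_cat X). \<exists>\<rho>\<in>c. \<exists>P\<in>pixels X Y. \<rho> ` {0..1} \<subseteq> P}"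

definition pixelation ::
  "'a topology \<Rightarrow> 'a set \<Rightarrow> ('a set, ((real \<Rightarrow> 'a set) set \<times> (real \<Rightarrow> 'a set) set) set) cat" where
  "pixelation X Y = fraction_cat (path_cat X) (pixel_arrows X Y)"

definition pseudo_arrow ::
  "'a topology \<Rightarrow> 'a set \<Rightarrow> ((real \<Rightarrow> 'a set) set \<times> (real \<Rightarrow> 'a set) set) set \<Rightarrow> bool" where
  "pseudo_arrow X Y m \<longleftrightarrow>
    (\<exists>\<gamma>\<in>path_set X. \<exists>\<rho>\<in>path_set X.
       \<gamma> 1 = \<rho> 1 \<and> path_class X \<rho> \<in> pixel_arrows X Y \<and>
       m = fraction_class (path_cat X) (pixel_arrows X Y) (path_class X \<rho>) (path_class X \<gamma>) \<and>
       (\<exists>I. interval_partition 1 I \<and>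
          (\<exists>P\<in>pixels X Y. \<exists>P'\<in>pixels X Y. P \<noteq> P' \<and> \<gamma> ` I 0 \<subseteq> P \<and> \<gamma> ` I 1 \<subseteq> P')))"

definition pixel_choice :: "'a topology \<Rightarrow> 'a set \<Rightarrow> ('a set set \<Rightarrow> 'a set) \<Rightarrow> bool" where
  "pixel_choice X Y s \<longleftrightarrow> (\<forall>P\<in>pixels X Y. s P \<in> P)"

definition pixel_quiver ::
  "'a topology \<Rightarrow> 'a set \<Rightarrow> ('a set set \<Rightarrow> 'a set) \<Rightarrow>
   ('a set set, 'a set set \<times> ((real \<Rightarrow> 'a set) set \<times> (real \<Rightarrow> 'a set) set) set \<times> 'a set set)
     pre_digraph" where
  "pixel_quiver X Y s =
    \<lparr>verts = pixels X Y,
     arcs = {(P, m, P'). P \<in> pixels X Y \<and> P' \<in> pixels X Y \<and> pseudo_arrow X Y m \<and>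
       Dom (pixelation X Y) m = s P \<and> Cod (pixelation X Y) m = s P'},
     tail = (\<lambda>(P, m, P'). P),
     head = (\<lambda>(P, m, P'). P')\<rparr>"

text \<open>
  The functor \<open>\<Psi>\<close> is \<open>s\<close> on vertices and sends the arc \<open>(P, m, P')\<close> to the pseudo arrow \<open>m\<close>;
  \<open>pixel_rel\<close> identifies parallel paths with the same image under \<open>\<Psi>\<close>.
\<close>

definition pixel_rel where
  "pixel_rel X Y s =
    {(f, g). f \<in> Ar (free_cat (pixel_quiver X Y s)) \<and> g \<in> Ar (free_cat (pixel_quiver X Y s)) \<and>
       Dom (free_cat (pixel_quiver X Y s)) f = Dom (free_cat (pixel_quiver X Y s)) g \<and>
       Cod (free_cat (pixel_quiver X Y s)) f = Cod (free_cat (pixel_quiver X Y s)) g \<and>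
       free_extension (pixelation X Y) s (\<lambda>(P, m, P'). m) f =
       free_extension (pixelation X Y) s (\<lambda>(P, m, P'). m) g}"

definition pixel_quiver_cat where
  "pixel_quiver_cat X Y s =
    quotient_cat (free_cat (pixel_quiver X Y s)) (pixel_rel X Y s)"

section \<open>Prime spectra and localisation\<close>

definition Spec :: "('a, 'b) ring_scheme \<Rightarrow> 'a set set" where
  "Spec R = {\<qq>. primeideal \<qq> R}"

definition zariski :: "('a, 'b) ring_scheme \<Rightarrow> 'a set topology" where
  "zariski R =
    topology (\<lambda>W. \<exists>E\<subseteq>carrier R. W = Spec R - {\<qq> \<in> Spec R. E \<subseteq> \<qq>})"

lemma istopology_zariski:
  "istopology (\<lambda>W. \<exists>E\<subseteq>carrier R. W = Spec R - {\<qq> \<in> Spec R. E \<subseteq> \<qq>})"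
  unfolding istopology_def
proof (intro conjI allI impI)
  fix V W
  assume "\<exists>E\<subseteq>carrier R. V = Spec R - {\<qq> \<in> Spec R. E \<subseteq> \<qq>}"
    and "\<exists>E\<subseteq>carrier R. W = Spec R - {\<qq> \<in> Spec R. E \<subseteq> \<qq>}"
  then obtain E F where E: "E \<subseteq> carrier R" "V = Spec R - {\<qq> \<in> Spec R. E \<subseteq> \<qq>}"
    and F: "F \<subseteq> carrier R" "W = Spec R - {\<qq> \<in> Spec R. F \<subseteq> \<qq>}"
    by blast
  let ?G = "{a \<otimes>\<^bsub>R\<^esub> b | a b. a \<in> E \<and> b \<in> F} \<inter> carrier R"
  have "?G \<subseteq> \<qq> \<longleftrightarrow> E \<subseteq> \<qq> \<or> F \<subseteq> \<qq>" if "\<qq> \<in> Spec R" for \<qq>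
  proof -
    interpret primeideal \<qq> R
      using that by (simp add: Spec_def)
    show ?thesis
    proof
      assume G: "?G \<subseteq> \<qq>"
      show "E \<subseteq> \<qq> \<or> F \<subseteq> \<qq>"
      proof (rule ccontr)
        assume "\<not> (E \<subseteq> \<qq> \<or> F \<subseteq> \<qq>)"
        then obtain a b where ab: "a \<in> E" "a \<notin> \<qq>" "b \<in> F" "b \<notin> \<qq>"
          by blast
        then have "a \<in> carrier R" "b \<in> carrier R"
          using E F by blast+
        with G ab I_prime[of a b] show False
          by blast
      qed
    next
      assume "E \<subseteq> \<qq> \<or> F \<subseteq> \<qq>"
      then show "?G \<subseteq> \<qq>"
        using E(1) F(1) I_l_closed I_r_closed by blast
    qed
  qed
  then have "V \<inter> W = Spec R - {\<qq> \<in> Spec R. ?G \<subseteq> \<qq>}"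
    using E F by blast
  then show "\<exists>E\<subseteq>carrier R. V \<inter> W = Spec R - {\<qq> \<in> Spec R. E \<subseteq> \<qq>}"
    by blast
next
  fix \<W>
  assume "\<forall>W\<in>\<W>. \<exists>E\<subseteq>carrier R. W = Spec R - {\<qq> \<in> Spec R. E \<subseteq> \<qq>}"
  then obtain e where e: "\<And>W. W \<in> \<W> \<Longrightarrow> e W \<subseteq> carrier R \<and> W = Spec R - {\<qq> \<in> Spec R. e W \<subseteq> \<qq>}"
    by metis
  have "\<Union>\<W> = Spec R - {\<qq> \<in> Spec R. \<Union>(e ` \<W>) \<subseteq> \<qq>}" (is "_ = ?U")
  proof
    show "\<Union>\<W> \<subseteq> ?U"
    proof
      fix \<qq>
      assume "\<qq> \<in> \<Union>\<W>"
      then obtain W where W: "W \<in> \<W>" "\<qq> \<in> W" by blast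
      then have "\<qq> \<in> Spec R" "\<not> e W \<subseteq> \<qq>"
        using e[OF W(1)] by blast+
      then show "\<qq> \<in> ?U" using W(1) by blast
    qed
    show "?U \<subseteq> \<Union>\<W>"
    proof
      fix \<qq>
      assume "\<qq> \<in> ?U"
      then obtain W where "W \<in> \<W>" "\<not> e W \<subseteq> \<qq>" "\<qq> \<in> Spec R" by blast
      then show "\<qq> \<in> \<Union>\<W>" using e[of W] by blast
    qed
  qed
  moreover have "\<Union>(e ` \<W>) \<subseteq> carrier R"
    using e by blast
  ultimately show "\<exists>E\<subseteq>carrier R. \<Union>\<W> = Spec R - {\<qq> \<in> Spec R. E \<subseteq> \<qq>}"
    by blast
qed

lemma openin_zariski:
  "openin (zariski R) W \<longleftrightarrow> (\<exists>E\<subseteq>carrier R. W = Spec R - {\<qq> \<in> Spec R. E \<subseteq> \<qq>})"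
  unfolding zariski_def by (simp only: topology_inverse'[OF istopology_zariski])

text \<open>The pair \<open>(a, s)\<close> is the formal fraction \<open>a / s\<close>.\<close>

definition localization_rel ::
  "('a, 'b) ring_scheme \<Rightarrow> 'a set \<Rightarrow> (('a \<times> 'a) \<times> ('a \<times> 'a)) set" where
  "localization_rel R S =
    {((a, s), (b, t)). a \<in> carrier R \<and> b \<in> carrier R \<and> s \<in> S \<and> t \<in> S \<and>
       (\<exists>u\<in>S. u \<otimes>\<^bsub>R\<^esub> (a \<otimes>\<^bsub>R\<^esub> t \<ominus>\<^bsub>R\<^esub> b \<otimes>\<^bsub>R\<^esub> s) = \<zero>\<^bsub>R\<^esub>)}"

definition localization :: "('a, 'b) ring_scheme \<Rightarrow> 'a set \<Rightarrow> ('a \<times> 'a) set ring" where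
  "localization R S =
    \<lparr>carrier = (carrier R \<times> S) // localization_rel R S,
     mult = (\<lambda>A B. \<Union>(a, s)\<in>A. \<Union>(b, t)\<in>B.
       localization_rel R S `` {(a \<otimes>\<^bsub>R\<^esub> b, s \<otimes>\<^bsub>R\<^esub> t)}),
     one = localization_rel R S `` {(\<one>\<^bsub>R\<^esub>, \<one>\<^bsub>R\<^esub>)},
     zero = localization_rel R S `` {(\<zero>\<^bsub>R\<^esub>, \<one>\<^bsub>R\<^esub>)},
     add = (\<lambda>A B. \<Union>(a, s)\<in>A. \<Union>(b, t)\<in>B.
       localization_rel R S `` {(a \<otimes>\<^bsub>R\<^esub> t \<oplus>\<^bsub>R\<^esub> b \<otimes>\<^bsub>R\<^esub> s, s \<otimes>\<^bsub>R\<^esub> t)})\<rparr>"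

definition localization_at :: "('a, 'b) ring_scheme \<Rightarrow> 'a set \<Rightarrow> ('a \<times> 'a) set ring" where
  "localization_at R \<pp> = localization R (carrier R - \<pp>)"

text \<open>
  Contraction along \<open>a \<mapsto> a / 1\<close>; it restricts to the canonical homeomorphism from the spectrum of
  the local ring at \<open>\<pp>\<close> onto the primes contained in \<open>\<pp>\<close>.
\<close>

definition contraction_at :: "('a, 'b) ring_scheme \<Rightarrow> 'a set \<Rightarrow> ('a \<times> 'a) set set \<Rightarrow> 'a set" where
  "contraction_at R \<pp> \<qq> =
    {a \<in> carrier R. localization_rel R (carrier R - \<pp>) `` {(a, \<one>\<^bsub>R\<^esub>)} \<in> \<qq>}"

definition primes_below :: "('a, 'b) ring_scheme \<Rightarrow> 'a set \<Rightarrow> 'a set set" where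
  "primes_below R \<pp> = {\<qq> \<in> Spec R. \<qq> \<subseteq> \<pp>}"

end

theory Submission
  imports Defs "HOL-Algebra.QuotRing" "HOL-Algebra.Multiplicative_Group"
begin

text \<open>
  All categories involved are thin. An arrow \<open>U \<rightarrow> V\<close> of the path category is determined by its
  endpoints and exists iff \<open>U \<subseteq> V\<close>. A fraction from \<open>U\<close> to \<open>V\<close> is a roof \<open>U \<subseteq> W \<supseteq> V\<close> with
  \<open>V \<inter> Y = W \<inter> Y\<close>; such a \<open>W\<close> exists iff \<open>U \<inter> Y \<subseteq> V \<inter> Y\<close>, with \<open>W = U \<union> V\<close> the smallest choice,
  and any two roofs are dominated by the union of their tops. Hence the pseudo arrows correspond
  to strict inclusions of traces on \<open>Y\<close>, and paths in the quiver, taken modulo \<open>\<Psi>\<close>, to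
  inclusions. For the second part, contraction is a homeomorphism from the spectrum of the localisation
  onto the subspace of primes avoiding the denominators, so it matches the open sets of both.
\<close>

section \<open>Thin categories\<close>

text \<open>Hom-sets with at most one element, each named explicitly by \<open>arr\<close>. The
  order \<open>leq\<close> is only a preorder: open sets with the same trace on \<open>Y\<close>
  will be comparable both ways. As \<open>Dom\<close> and \<open>Cod\<close> recover the endpoints
  of \<open>arr\<close>, each law of a category becomes a fact about \<open>leq\<close>.\<close>

locale thin_category =
  fixes C :: "('o, 'm) cat" and leq :: "'o \<Rightarrow> 'o \<Rightarrow> bool" and arr :: "'o \<Rightarrow> 'o \<Rightarrow> 'm"
  assumes le_refl: "x \<in> Ob C \<Longrightarrow> leq x x"
    and le_trans: "\<lbrakk>x \<in> Ob C; y \<in> Ob C; z \<in> Ob C; leq x y; leq y z\<rbrakk> \<Longrightarrow> leq x z"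
    and Ar_eq: "Ar C = {arr x y | x y. x \<in> Ob C \<and> y \<in> Ob C \<and> leq x y}"
    and Dom_arr: "\<lbrakk>x \<in> Ob C; y \<in> Ob C; leq x y\<rbrakk> \<Longrightarrow> Dom C (arr x y) = x"
    and Cod_arr: "\<lbrakk>x \<in> Ob C; y \<in> Ob C; leq x y\<rbrakk> \<Longrightarrow> Cod C (arr x y) = y"
    and Ident_arr: "x \<in> Ob C \<Longrightarrow> Ident C x = arr x x"
    and Comp_arr: "\<lbrakk>x \<in> Ob C; y \<in> Ob C; z \<in> Ob C; leq x y; leq y z\<rbrakk>
      \<Longrightarrow> Comp C (arr y z) (arr x y) = arr x z"
begin

lemma arr_in: "\<lbrakk>x \<in> Ob C; y \<in> Ob C; leq x y\<rbrakk> \<Longrightarrow> arr x y \<in> Ar C"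
  unfolding Ar_eq by blast

lemma ArE:
  assumes "f \<in> Ar C"
  obtains x y where "x \<in> Ob C" "y \<in> Ob C" "leq x y" "f = arr x y"
    "Dom C f = x" "Cod C f = y"
  using assms Dom_arr Cod_arr unfolding Ar_eq by blast

lemma is_category: "category C"
proof
  fix f g h
  assume "f \<in> Ar C" "g \<in> Ar C" "h \<in> Ar C" "Cod C f = Dom C g" "Cod C g = Dom C h"
  then show "Comp C h (Comp C g f) = Comp C (Comp C h g) f"
    by (elim ArE) (metis Comp_arr le_trans)
next
  fix f g
  assume "f \<in> Ar C" "g \<in> Ar C" "Cod C f = Dom C g"
  then show "Comp C g f \<in> Ar C" "Dom C (Comp C g f) = Dom C f" "Cod C (Comp C g f) = Cod C g"
    by (elim ArE, metis Comp_arr le_trans arr_in Dom_arr Cod_arr)+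
next
  fix f
  assume "f \<in> Ar C"
  then show "Dom C f \<in> Ob C" "Cod C f \<in> Ob C" "Comp C f (Ident C (Dom C f)) = f"
    "Comp C (Ident C (Cod C f)) f = f"
    by (elim ArE, simp add: Ident_arr Comp_arr le_refl)+
qed (simp_all add: Ident_arr arr_in Dom_arr Cod_arr le_refl)

end

text \<open>The object part of a functor between thin categories forces its arrow part, so an
  isomorphism of preorders on objects is enough. Both claims of the theorem are thereby reduced to
  comparing orders.\<close>

lemma thin_category_iso:
  assumes C: "thin_category C leq arr" and D: "thin_category D leq' arr'"
    and bij: "bij_betw Fo (Ob C) (Ob D)"
    and mono: "\<And>x y. \<lbrakk>x \<in> Ob C; y \<in> Ob C\<rbrakk> \<Longrightarrow> leq' (Fo x) (Fo y) \<longleftrightarrow> leq x y"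
  shows "category_iso C D Fo (\<lambda>f. arr' (Fo (Dom C f)) (Fo (Cod C f)))" (is "category_iso C D Fo ?Fa")
proof -
  interpret C: thin_category C leq arr by fact
  interpret D: thin_category D leq' arr' by fact
  interpret CC: category C by (rule C.is_category)
  interpret DD: category D by (rule D.is_category)
  have Fo: "Fo x \<in> Ob D" if "x \<in> Ob C" for x
    using bij that by (auto simp: bij_betw_def)
  have Fa: "?Fa (arr x y) = arr' (Fo x) (Fo y)" if "x \<in> Ob C" "y \<in> Ob C" "leq x y" for x y
    using that by (simp add: C.Dom_arr C.Cod_arr)
  show ?thesis
  proof
    show "bij_betw ?Fa (Ar C) (Ar D)"
    proof (rule bij_betw_imageI)
      show "inj_on ?Fa (Ar C)"
      proof (rule inj_onI)
        fix f g
        assume "f \<in> Ar C" "g \<in> Ar C" "?Fa f = ?Fa g"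
        then obtain x y z w where fg: "f = arr x y" "g = arr z w" "x \<in> Ob C" "y \<in> Ob C"
          "z \<in> Ob C" "w \<in> Ob C" "leq x y" "leq z w" "arr' (Fo x) (Fo y) = arr' (Fo z) (Fo w)"
          by (elim C.ArE) auto
        \<comment> \<open>By \<open>mono\<close> both images are genuine arrows of \<open>D\<close>,
          so their endpoints can be read off by \<open>Dom\<close> and \<open>Cod\<close>.\<close>
        then have "Fo x = Fo z" "Fo y = Fo w"
          using Fo mono D.Dom_arr D.Cod_arr by metis+
        then have "x = z" "y = w"
          using fg bij by (auto simp: bij_betw_def inj_on_def)
        then show "f = g" using fg by simp
      qed
      show "?Fa ` Ar C = Ar D"
      proof
        show "?Fa ` Ar C \<subseteq> Ar D"
          by (auto elim!: C.ArE simp: mono intro!: D.arr_in Fo)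
        show "Ar D \<subseteq> ?Fa ` Ar C"
        proof
          fix g
          assume "g \<in> Ar D"
          then obtain x' y' where g: "x' \<in> Ob D" "y' \<in> Ob D" "leq' x' y'" "g = arr' x' y'"
            by (elim D.ArE)
          have "x' \<in> Fo ` Ob C" "y' \<in> Fo ` Ob C"
            using bij g by (simp_all add: bij_betw_def)
          then obtain x y where xy: "x \<in> Ob C" "y \<in> Ob C" "x' = Fo x" "y' = Fo y"
            by blast
          then have "leq x y" using g mono by simp
          with xy have "arr x y \<in> Ar C" "?Fa (arr x y) = g"
            using C.arr_in Fa g by simp_all
          then show "g \<in> ?Fa ` Ar C"
            by blast
        qed
      qed
    qed
  next
    fix f
    assume "f \<in> Ar C"
    then obtain x y where f: "x \<in> Ob C" "y \<in> Ob C" "leq x y" "Dom C f = x" "Cod C f = y"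
      by (elim C.ArE)
    then have "leq' (Fo x) (Fo y)" "Fo x \<in> Ob D" "Fo y \<in> Ob D"
      using mono Fo by auto
    then show "?Fa f \<in> Ar D" "Dom D (?Fa f) = Fo (Dom C f)" "Cod D (?Fa f) = Fo (Cod C f)"
      unfolding f by (simp_all add: D.arr_in D.Dom_arr D.Cod_arr)
  next
    fix x
    assume "x \<in> Ob C"
    then show "?Fa (Ident C x) = Ident D (Fo x)"
      by (simp add: C.Ident_arr D.Ident_arr Fa C.le_refl Fo)
  next
    fix f g
    assume "f \<in> Ar C" "g \<in> Ar C" "Cod C f = Dom C g"
    then obtain x y z where fg: "x \<in> Ob C" "y \<in> Ob C" "z \<in> Ob C" "leq x y" "leq y z"
      "f = arr x y" "g = arr y z"
      by (elim C.ArE) auto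
    then have "leq x z" "leq' (Fo x) (Fo y)" "leq' (Fo y) (Fo z)"
      using C.le_trans mono by blast+
    then show "?Fa (Comp C g f) = Comp D (?Fa g) (?Fa f)"
      using fg by (simp add: C.Comp_arr Fa D.Comp_arr Fo)
  qed (use Fo bij in simp_all)
qed

lemma thin_top_cat: "thin_category (top_cat X) (\<subseteq>) Pair"
  by unfold_locales (auto simp: top_cat_def)

section \<open>The path category\<close>

text \<open>Since \<open>path_rel\<close> compares endpoints only, this is the full class of any
  path from \<open>U\<close> to \<open>V\<close>; it serves as the unique arrow between
  them.\<close>

definition path_arr :: "'a topology \<Rightarrow> 'a set \<Rightarrow> 'a set \<Rightarrow> (real \<Rightarrow> 'a set) set" where
  "path_arr X U V = {\<gamma> \<in> path_set X. \<gamma> 0 = U \<and> \<gamma> 1 = V}"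

text \<open>The middle piece is closed: for \<open>c = d\<close> it shrinks to a point, and two such
  paths with a common constant stretch glue at 1/2 to a path of the same shape.\<close>

definition step_path :: "real \<Rightarrow> real \<Rightarrow> 'a set \<Rightarrow> 'a set \<Rightarrow> 'a set \<Rightarrow> real \<Rightarrow> 'a set" where
  "step_path c d U V W = (\<lambda>t\<in>{0..1}. if t < c then U else if t \<le> d then V else W)"

lemma step_path_in_path_set:
  assumes "0 < c" "c \<le> d" "d < 1" "openin X U" "openin X V" "openin X W" "U \<subseteq> V" "V \<subseteq> W"
  shows "step_path c d U V W \<in> path_set X"
proof -
  \<comment> \<open>These are the pieces for \<open>n = 2\<close>; they are nonempty by
    \<open>0 < c\<close>, \<open>c \<le> d\<close> and \<open>d < 1\<close>.\<close>
  define I :: "nat \<Rightarrow> real set"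
    where "I i = (if i = 0 then {0..<c} else if i = 1 then {c..d} else {d<..1})" for i
  define A where "A i = (if i = 0 then U else if i = 1 then V else W)" for i :: nat
  have le2: "i \<le> 2 \<longleftrightarrow> i = 0 \<or> i = 1 \<or> i = 2" for i :: nat
    by auto
  have lt2: "i < 2 \<longleftrightarrow> i = 0 \<or> i = 1" for i :: nat
    by auto
  have "{..2::nat} = {0, 1, 2}" by auto
  then have "(\<Union>i\<le>2. I i) = {0..1}"
    using assms by (auto simp: I_def)
  then have "interval_partition 2 I"
    using assms unfolding interval_partition_def
    by (auto simp: I_def is_interval_cc is_interval_co is_interval_oc le2)
  moreover have "\<forall>i\<le>2. openin X (A i)" "\<forall>i<2. A i \<subseteq> A (Suc i)"
    using assms by (auto simp: A_def lt2)
  moreover have "\<forall>i\<le>2. \<forall>t\<in>I i. step_path c d U V W t = A i"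
    using assms by (auto simp: A_def I_def step_path_def le2)
  moreover have "step_path c d U V W \<in> extensional {0..1}"
    by (simp add: step_path_def)
  ultimately show ?thesis
    unfolding path_set_def mem_Collect_eq by (intro conjI exI[of _ 2] exI[of _ I] exI[of _ A]) auto
qed

text \<open>The point 0 lies in some piece \<open>I i\<close> and 1 in some \<open>I j\<close>. The
  order of the pieces excludes \<open>j < i\<close>, so the increasing chain of open sets gives the
  inclusion. Hence arrows exist only along inclusions.\<close>

lemma path_set_endpoints:
  assumes "\<gamma> \<in> path_set X"
  shows "openin X (\<gamma> 0)" "openin X (\<gamma> 1)" "\<gamma> 0 \<subseteq> \<gamma> 1"
proof -
  obtain n I U where I: "interval_partition n I" and U: "\<forall>i\<le>n. openin X (U i)"
    and mono: "\<forall>i<n. U i \<subseteq> U (Suc i)" and \<gamma>: "\<forall>i\<le>n. \<forall>t\<in>I i. \<gamma> t = U i"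
    using assms unfolding path_set_def mem_Collect_eq
    by (elim conjE exE) (rule that; assumption)
  have "(0::real) \<in> (\<Union>i\<le>n. I i)" "(1::real) \<in> (\<Union>i\<le>n. I i)"
    using I by (auto simp: interval_partition_def)
  then obtain i j where i: "i \<le> n" "0 \<in> I i" and j: "j \<le> n" "1 \<in> I j"
    by auto
  have "\<not> j < i"
  proof
    assume "j < i"
    then have "\<forall>s\<in>I j. \<forall>t\<in>I i. s < t"
      using I i(1) unfolding interval_partition_def by blast
    then have "(1::real) < 0" using i(2) j(2) by blast
    then show False by simp
  qed
  then have "i \<le> j" by simp
  then have "U i \<subseteq> U j" using j(1)
  proof (induction j rule: dec_induct)
    case (step k)
    then show ?case using mono by (meson Suc_le_lessD less_imp_le order_trans)
  qed simp
  with i j U \<gamma> show "openin X (\<gamma> 0)" "openin X (\<gamma> 1)" "\<gamma> 0 \<subseteq> \<gamma> 1"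
    by auto
qed

lemma path_class_eq: "\<gamma> \<in> path_set X \<Longrightarrow> path_class X \<gamma> = path_arr X (\<gamma> 0) (\<gamma> 1)"
  by (auto simp: path_class_def path_rel_def path_arr_def)

lemma step_path_in_path_arr:
  assumes "openin X U" "openin X V" "U \<subseteq> V"
  shows "step_path (1/2) (1/2) U V V \<in> path_arr X U V"
    and "step_path (1/2) (1/2) U U V \<in> path_arr X U V"
  using assms by (auto simp: path_arr_def intro!: step_path_in_path_set)
    (auto simp: step_path_def)

lemma path_concat_step_path:
  "path_concat (step_path (1/2) (1/2) U V V) (step_path (1/2) (1/2) V V W) =
   step_path (1/4) (3/4) U V W"
  by (auto simp: path_concat_def step_path_def fun_eq_iff)

lemma path_concat_endpoints: "path_concat \<gamma> \<delta> 0 = \<gamma> 0" "path_concat \<gamma> \<delta> 1 = \<delta> 1"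
  by (simp_all add: path_concat_def)

lemma Ob_path_cat: "Ob (path_cat X) = {U. openin X U}"
  by (simp add: path_cat_def)

text \<open>Composition is a union over all representatives. A concatenation outside
  \<open>path_set\<close> would have an empty \<open>path_class\<close>, so one inclusion needs
  endpoints only. For the other, a single pair of step paths, whose concatenation is again a step
  path, contributes the whole class.\<close>

lemma Comp_path_arr:
  assumes "openin X U" "openin X V" "openin X W" "U \<subseteq> V" "V \<subseteq> W"
  shows "Comp (path_cat X) (path_arr X V W) (path_arr X U V) = path_arr X U W"
proof
  have "path_class X (path_concat \<gamma> \<delta>) \<subseteq> path_arr X U W"
    if "\<gamma> \<in> path_arr X U V" "\<delta> \<in> path_arr X V W" for \<gamma> \<delta>
    using that path_concat_endpoints[of \<gamma> \<delta>]
    by (auto simp: path_class_def path_rel_def path_arr_def)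
  then show "Comp (path_cat X) (path_arr X V W) (path_arr X U V) \<subseteq> path_arr X U W"
    by (auto simp: path_cat_def)
  have "path_class X (step_path (1/4) (3/4) U V W) = path_arr X U W"
    using step_path_in_path_set[of "1/4" "3/4" X U V W] assms
    by (subst path_class_eq) (simp_all add: step_path_def)
  then show "path_arr X U W \<subseteq> Comp (path_cat X) (path_arr X V W) (path_arr X U V)"
    using step_path_in_path_arr(1)[of X U V] step_path_in_path_arr(2)[of X V W] assms
    unfolding path_cat_def path_concat_step_path[symmetric] by fastforce
qed

lemma thin_path_cat: "thin_category (path_cat X) (\<subseteq>) (path_arr X)"
proof
  show "Ar (path_cat X) = {path_arr X U V | U V. U \<in> Ob (path_cat X) \<and> V \<in> Ob (path_cat X) \<and> U \<subseteq> V}"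
    (is "?L = ?R")
  proof
    show "?L \<subseteq> ?R"
      using path_set_endpoints path_class_eq
      by (fastforce simp: path_cat_def quotient_def path_class_def)
    show "?R \<subseteq> ?L"
    proof
      fix c
      assume "c \<in> ?R"
      then obtain U V where c: "c = path_arr X U V" "openin X U" "openin X V" "U \<subseteq> V"
        by (auto simp: path_cat_def)
      let ?\<gamma> = "step_path (1/2) (1/2) U V V"
      have "?\<gamma> \<in> path_set X" "path_class X ?\<gamma> = c"
        using step_path_in_path_arr(1)[of X U V] c path_class_eq[of ?\<gamma> X]
        by (auto simp: path_arr_def)
      then show "c \<in> ?L"
        by (auto simp: path_cat_def quotient_def path_class_def)
    qed
  qed
next
  fix U V
  assume "U \<in> Ob (path_cat X)" "V \<in> Ob (path_cat X)" "U \<subseteq> V"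
  then have "step_path (1/2) (1/2) U V V \<in> path_arr X U V"
    by (intro step_path_in_path_arr) (auto simp: Ob_path_cat)
  then have "(\<lambda>\<gamma>. \<gamma> 0) ` path_arr X U V = {U}" "(\<lambda>\<gamma>. \<gamma> 1) ` path_arr X U V = {V}"
    by (auto simp: path_arr_def image_iff)
  then show "Dom (path_cat X) (path_arr X U V) = U" "Cod (path_cat X) (path_arr X U V) = V"
    by (simp_all add: path_cat_def)
next
  fix U
  assume "U \<in> Ob (path_cat X)"
  \<comment> \<open>Partitions in \<open>path_set\<close> have at least two pieces, so the constant
    path is exhibited as a degenerate step path.\<close>
  then have "step_path (1/2) (1/2) U U U \<in> path_set X"
    by (auto simp: Ob_path_cat intro!: step_path_in_path_set)
  moreover have "step_path (1/2) (1/2) U U U = (\<lambda>t\<in>{0..1}. U)"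
    by (simp add: step_path_def fun_eq_iff restrict_def)
  ultimately show "Ident (path_cat X) U = path_arr X U U"
    using path_class_eq by (fastforce simp: path_cat_def)
next
  fix U V W
  assume "U \<in> Ob (path_cat X)" "V \<in> Ob (path_cat X)" "W \<in> Ob (path_cat X)" "U \<subseteq> V" "V \<subseteq> W"
  then show "Comp (path_cat X) (path_arr X V W) (path_arr X U V) = path_arr X U W"
    by (intro Comp_path_arr) (auto simp: Ob_path_cat)
qed auto

section \<open>Pixelation\<close>

lemma pixel_in_pixels: "openin X U \<Longrightarrow> pixel X Y (U \<inter> Y) \<in> pixels X Y"
  by (auto simp: pixels_def pixel_def)

lemma pixels_inter_eq: "\<lbrakk>P \<in> pixels X Y; U \<in> P; V \<in> P\<rbrakk> \<Longrightarrow> U \<inter> Y = V \<inter> Y"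
  by (auto simp: pixels_def pixel_def)

lemma pixels_eq_pixel: "\<lbrakk>P \<in> pixels X Y; U \<in> P\<rbrakk> \<Longrightarrow> P = pixel X Y (U \<inter> Y) \<and> openin X U"
  by (auto simp: pixels_def pixel_def)

context
  fixes X :: "'a topology" and Y :: "'a set"
begin

interpretation path: thin_category "path_cat X" "(\<subseteq>)" "path_arr X"
  by (rule thin_path_cat)

lemma path_arr_in: "\<lbrakk>openin X U; openin X V; U \<subseteq> V\<rbrakk> \<Longrightarrow> path_arr X U V \<in> Ar (path_cat X)"
  by (simp add: path.arr_in Ob_path_cat)

lemma Dom_path_arr: "\<lbrakk>openin X U; openin X V; U \<subseteq> V\<rbrakk> \<Longrightarrow> Dom (path_cat X) (path_arr X U V) = U"
  by (simp add: path.Dom_arr Ob_path_cat)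

lemma Cod_path_arr: "\<lbrakk>openin X U; openin X V; U \<subseteq> V\<rbrakk> \<Longrightarrow> Cod (path_cat X) (path_arr X U V) = V"
  by (simp add: path.Cod_arr Ob_path_cat)

text \<open>Only one representative has to stay inside a pixel. Its endpoints give one direction;
  for the other, the step path with values \<open>U\<close> and \<open>V\<close> never leaves the
  pixel of \<open>U\<close>.\<close>

lemma path_arr_in_pixel_arrows_iff:
  assumes "openin X U" "openin X V" "U \<subseteq> V"
  shows "path_arr X U V \<in> pixel_arrows X Y \<longleftrightarrow> U \<inter> Y = V \<inter> Y"
proof
  assume "path_arr X U V \<in> pixel_arrows X Y"
  then obtain \<rho> P where "\<rho> \<in> path_arr X U V" "P \<in> pixels X Y" "\<rho> ` {0..1} \<subseteq> P"
    by (auto simp: pixel_arrows_def)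
  then show "U \<inter> Y = V \<inter> Y"
    by (intro pixels_inter_eq[of P X]) (auto simp: path_arr_def)
next
  assume "U \<inter> Y = V \<inter> Y"
  then have "step_path (1/2) (1/2) U V V ` {0..1} \<subseteq> pixel X Y (U \<inter> Y)"
    using assms by (auto simp: step_path_def pixel_def)
  then show "path_arr X U V \<in> pixel_arrows X Y"
    using assms path_arr_in step_path_in_path_arr(1)[of X U V] pixel_in_pixels[of X U Y]
    unfolding pixel_arrows_def by blast
qed

section \<open>Roofs and the arrows of the category of fractions\<close>

definition pixel_le :: "'a set \<Rightarrow> 'a set \<Rightarrow> bool" where
  "pixel_le U V \<longleftrightarrow> U \<inter> Y \<subseteq> V \<inter> Y"

text \<open>The fraction \<open>s\<^sup>-\<^sup>1 f\<close> with legs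
  \<open>f : U \<rightarrow> W\<close> and \<open>s : V \<rightarrow> W\<close>; the equation of
  traces says that \<open>s\<close> is one of the inverted arrows.\<close>

definition pixel_roof :: "'a set \<Rightarrow> 'a set \<Rightarrow> 'a set \<Rightarrow> bool" where
  "pixel_roof U V W \<longleftrightarrow> openin X U \<and> openin X V \<and> openin X W \<and> U \<subseteq> W \<and> V \<subseteq> W \<and> V \<inter> Y = W \<inter> Y"

text \<open>All tops \<open>W\<close> are collected because the fractions from \<open>U\<close> to
  \<open>V\<close> turn out to form a single class.\<close>

definition pixel_arr :: "'a set \<Rightarrow> 'a set \<Rightarrow> ((real \<Rightarrow> 'a set) set \<times> (real \<Rightarrow> 'a set) set) set" where
  "pixel_arr U V = {(path_arr X U W, path_arr X V W) | W. pixel_roof U V W}"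

lemma pixel_roof_le: "pixel_roof U V W \<Longrightarrow> pixel_le U V"
  by (auto simp: pixel_roof_def pixel_le_def)

text \<open>By \<open>pixel_le U V\<close>, adjoining \<open>U\<close> to \<open>V\<close> adds
  nothing inside \<open>Y\<close>, so the right leg is inverted.\<close>

lemma pixel_roof_union:
  "\<lbrakk>openin X U; openin X V; pixel_le U V\<rbrakk> \<Longrightarrow> pixel_roof U V (U \<union> V)"
  by (auto simp: pixel_roof_def pixel_le_def)

lemma pixel_roof_ex_iff:
  "(\<exists>W. pixel_roof U V W) \<longleftrightarrow> openin X U \<and> openin X V \<and> pixel_le U V"
proof
  assume "\<exists>W. pixel_roof U V W"
  then obtain W where W: "pixel_roof U V W" ..
  then show "openin X U \<and> openin X V \<and> pixel_le U V"
    using pixel_roof_le[OF W] by (simp add: pixel_roof_def)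
next
  assume "openin X U \<and> openin X V \<and> pixel_le U V"
  then show "\<exists>W. pixel_roof U V W"
    using pixel_roof_union by blast
qed

lemma fractions_path_cat:
  "fractions (path_cat X) (pixel_arrows X Y) =
    {(path_arr X U W, path_arr X V W) | U V W. pixel_roof U V W}" (is "?L = ?R")
proof
  show "?R \<subseteq> ?L"
    by (auto simp: fractions_def pixel_roof_def path_arr_in Cod_path_arr
        path_arr_in_pixel_arrows_iff)
  show "?L \<subseteq> ?R"
  proof clarify
    fix f s
    assume "(f, s) \<in> ?L"
    then have fs: "f \<in> Ar (path_cat X)" "s \<in> Ar (path_cat X)" "s \<in> pixel_arrows X Y"
      "Cod (path_cat X) f = Cod (path_cat X) s"
      by (auto simp: fractions_def)
    obtain U W V W' where "openin X U" "openin X W" "openin X V" "openin X W'"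
      "U \<subseteq> W" "V \<subseteq> W'" "f = path_arr X U W" "s = path_arr X V W'" "W = W'"
      using fs by (elim path.ArE) (auto simp: Ob_path_cat)
    then show "\<exists>U V W. (f, s) = (path_arr X U W, path_arr X V W) \<and> pixel_roof U V W"
      using fs by (auto simp: pixel_roof_def path_arr_in_pixel_arrows_iff)
  qed
qed

text \<open>Related fractions share both domains, so the class stays inside
  \<open>pixel_arr U V\<close>. Conversely the tops \<open>W\<close> and \<open>W'\<close> of two
  roofs lie in \<open>W \<union> W'\<close>, which still has the trace of \<open>V\<close> and
  serves as a common denominator.\<close>

lemma fraction_class_path_arr:
  assumes "pixel_roof U V W"
  shows "fraction_class (path_cat X) (pixel_arrows X Y) (path_arr X V W) (path_arr X U W) =
    pixel_arr U V" (is "?L = _")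
proof
  show "?L \<subseteq> pixel_arr U V"
  proof clarify
    fix g t
    assume "(g, t) \<in> ?L"
    then have "(g, t) \<in> fractions (path_cat X) (pixel_arrows X Y)"
      and dom: "Dom (path_cat X) (path_arr X U W) = Dom (path_cat X) g"
      "Dom (path_cat X) (path_arr X V W) = Dom (path_cat X) t"
      unfolding fraction_class_def fraction_rel_def by blast+
    then obtain U' V' W' where gt: "g = path_arr X U' W'" "t = path_arr X V' W'"
      "pixel_roof U' V' W'"
      unfolding fractions_path_cat by blast
    with dom assms have "U = U'" "V = V'"
      by (auto simp: pixel_roof_def Dom_path_arr)
    with gt show "(g, t) \<in> pixel_arr U V"
      by (auto simp: pixel_arr_def)
  qed
  show "pixel_arr U V \<subseteq> ?L"
  proof clarify
    fix g t
    assume "(g, t) \<in> pixel_arr U V"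
    then obtain W' where gt: "g = path_arr X U W'" "t = path_arr X V W'" "pixel_roof U V W'"
      by (auto simp: pixel_arr_def)
    have op: "openin X (W \<union> W')" "openin X U" "openin X V" "openin X W" "openin X W'"
      and sub: "U \<subseteq> W" "V \<subseteq> W" "U \<subseteq> W'" "V \<subseteq> W'" "U \<subseteq> W \<union> W'" "V \<subseteq> W \<union> W'"
      and eq: "V \<inter> Y = (W \<union> W') \<inter> Y"
      using assms gt by (auto simp: pixel_roof_def)
    let ?u = "path_arr X W (W \<union> W')" and ?v = "path_arr X W' (W \<union> W')"
    have "?u \<in> Ar (path_cat X)" "?v \<in> Ar (path_cat X)"
      using op by (auto intro!: path_arr_in)
    moreover have "(path_arr X U W, path_arr X V W) \<in> fractions (path_cat X) (pixel_arrows X Y)"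
      "(g, t) \<in> fractions (path_cat X) (pixel_arrows X Y)"
      using gt assms unfolding fractions_path_cat by blast+
    moreover have "path_arr X V (W \<union> W') \<in> pixel_arrows X Y"
      using op sub eq by (simp add: path_arr_in_pixel_arrows_iff)
    ultimately show "(g, t) \<in> ?L"
      using op sub
      unfolding fraction_class_def fraction_rel_def gt Image_singleton_iff mem_Collect_eq prod.case
      by (intro conjI bexI[of _ ?u] bexI[of _ ?v]) (simp_all add: Dom_path_arr Cod_path_arr Comp_path_arr)
  qed
qed

lemma pixelation_simps:
  "Ob (pixelation X Y) = {U. openin X U}"
  "Ar (pixelation X Y) =
     fractions (path_cat X) (pixel_arrows X Y) // fraction_rel (path_cat X) (pixel_arrows X Y)"
  "Dom (pixelation X Y) c = the_elem ((\<lambda>(f, s). Dom (path_cat X) f) ` c)"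
  "Cod (pixelation X Y) c = the_elem ((\<lambda>(f, s). Dom (path_cat X) s) ` c)"
  "Ident (pixelation X Y) U = fraction_class (path_cat X) (pixel_arrows X Y)
     (Ident (path_cat X) U) (Ident (path_cat X) U)"
  by (simp_all add: pixelation_def fraction_cat_def path_cat_def)

text \<open>The composite is a union over all completions of a square. Each completion contributes
  the same class, since its corner is the top of a roof from \<open>U\<close> to \<open>W\<close>;
  unions of the open sets involved provide at least one completion.\<close>

lemma Comp_pixel_arr:
  assumes "openin X U" "openin X V" "openin X W" "pixel_le U V" "pixel_le V W"
  shows "Comp (pixelation X Y) (pixel_arr V W) (pixel_arr U V) = pixel_arr U W"
proof -
  let ?C = "path_cat X" and ?S = "pixel_arrows X Y"
  define F where "F = {fraction_class ?C ?S (Comp ?C s' t) (Comp ?C g' f) | f s g t g' s'.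
        (f, s) \<in> pixel_arr U V \<and> (g, t) \<in> pixel_arr V W \<and> g' \<in> Ar ?C \<and> s' \<in> Ar ?C \<and> s' \<in> ?S \<and>
        Dom ?C g' = Cod ?C s \<and> Dom ?C s' = Cod ?C g \<and> Cod ?C g' = Cod ?C s' \<and>
        Comp ?C g' s = Comp ?C s' g}"
  have "c = pixel_arr U W" if c: "c \<in> F" for c
  proof -
    obtain f s g t g' s' where fs: "(f, s) \<in> pixel_arr U V" and gt: "(g, t) \<in> pixel_arr V W"
      and gs': "g' \<in> Ar ?C" "s' \<in> Ar ?C" "s' \<in> ?S"
        "Dom ?C g' = Cod ?C s" "Dom ?C s' = Cod ?C g" "Cod ?C g' = Cod ?C s'"
      and c: "c = fraction_class ?C ?S (Comp ?C s' t) (Comp ?C g' f)"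
      using c unfolding F_def by blast
    obtain A where A: "f = path_arr X U A" "s = path_arr X V A" "pixel_roof U V A"
      using fs by (auto simp: pixel_arr_def)
    obtain B where B: "g = path_arr X V B" "t = path_arr X W B" "pixel_roof V W B"
      using gt by (auto simp: pixel_arr_def)
    have cod: "Cod ?C s = A" "Cod ?C g = B"
      using A B by (auto simp: pixel_roof_def Cod_path_arr)
    obtain D where D: "openin X D" "A \<subseteq> D" "g' = path_arr X A D" "Cod ?C g' = D"
      using gs' cod by (elim path.ArE) (auto simp: Ob_path_cat)
    moreover obtain D' where D': "openin X D'" "B \<subseteq> D'" "s' = path_arr X B D'" "Cod ?C s' = D'"
      using gs'(2) gs' cod by (elim path.ArE) (auto simp: Ob_path_cat)
    moreover have "D' = D" using D D' gs' by simp
    \<comment> \<open>Here it matters that \<open>s'\<close> is an inverted arrow: with the roof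
      over \<open>V\<close> and \<open>W\<close>, the corner \<open>D\<close> acquires the trace of
      \<open>W\<close>.\<close>
    moreover have "B \<inter> Y = D \<inter> Y"
      using gs'(3) D D' \<open>D' = D\<close> B by (simp add: path_arr_in_pixel_arrows_iff pixel_roof_def)
    ultimately have "pixel_roof U W D" "Comp ?C g' f = path_arr X U D"
      "Comp ?C s' t = path_arr X W D"
      using A B by (auto simp: pixel_roof_def Comp_path_arr)
    then show ?thesis
      using c fraction_class_path_arr by simp
  qed
  moreover have "F \<noteq> {}"
  proof -
    let ?A = "U \<union> V" and ?B = "V \<union> W" and ?D = "U \<union> V \<union> W"
    have "(path_arr X U ?A, path_arr X V ?A) \<in> pixel_arr U V"
      "(path_arr X V ?B, path_arr X W ?B) \<in> pixel_arr V W"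
      using assms pixel_roof_union unfolding pixel_arr_def by blast+
    \<comment> \<open>The traces increase from \<open>U\<close> to \<open>V\<close>, so adjoining
      \<open>U\<close> changes nothing on \<open>Y\<close>.\<close>
    moreover have "?B \<inter> Y = ?D \<inter> Y"
      using assms by (auto simp: pixel_le_def)
    then have "path_arr X ?B ?D \<in> ?S"
      using assms by (intro path_arr_in_pixel_arrows_iff[THEN iffD2]) auto
    moreover have "path_arr X ?B ?D \<in> Ar ?C" "path_arr X ?A ?D \<in> Ar ?C"
      using assms by (auto intro!: path_arr_in)
    moreover have "Dom ?C (path_arr X ?A ?D) = Cod ?C (path_arr X V ?A)"
      "Dom ?C (path_arr X ?B ?D) = Cod ?C (path_arr X V ?B)"
      "Cod ?C (path_arr X ?A ?D) = Cod ?C (path_arr X ?B ?D)"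
      "Comp ?C (path_arr X ?A ?D) (path_arr X V ?A) = Comp ?C (path_arr X ?B ?D) (path_arr X V ?B)"
      using assms by (simp_all add: Dom_path_arr Cod_path_arr Comp_path_arr openin_Un Un_assoc
          le_supI1 le_supI2)
    ultimately show ?thesis
      unfolding F_def by blast
  qed
  ultimately have "\<Union>F = pixel_arr U W" by blast
  then show ?thesis
    by (simp add: F_def pixelation_def fraction_cat_def)
qed

text \<open>Fraction classes forget the top of a roof, and a top exists exactly when the traces are
  comparable; what remains is one arrow for each comparable pair.\<close>

lemma thin_pixelation: "thin_category (pixelation X Y) pixel_le pixel_arr"
proof
  have "Ar (pixelation X Y) = (\<lambda>(f, s). fraction_class (path_cat X) (pixel_arrows X Y) s f) `
      fractions (path_cat X) (pixel_arrows X Y)"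
    by (auto simp: pixelation_simps quotient_def fraction_class_def)
  also have "\<dots> = (\<lambda>(U, V, W). pixel_arr U V) ` {(U, V, W). pixel_roof U V W}"
  proof -
    have "fractions (path_cat X) (pixel_arrows X Y) =
        (\<lambda>(U, V, W). (path_arr X U W, path_arr X V W)) ` {(U, V, W). pixel_roof U V W}"
      unfolding fractions_path_cat by (auto simp: image_def)
    then show ?thesis
      by (simp only: image_image) (rule image_cong, auto simp: fraction_class_path_arr)
  qed
  also have "\<dots> = {pixel_arr U V | U V. \<exists>W. pixel_roof U V W}"
    by (auto simp: image_def)
  also have "\<dots> = {pixel_arr U V | U V. openin X U \<and> openin X V \<and> pixel_le U V}"
    by (simp only: pixel_roof_ex_iff)
  finally show "Ar (pixelation X Y) =
      {pixel_arr U V | U V. U \<in> Ob (pixelation X Y) \<and> V \<in> Ob (pixelation X Y) \<and> pixel_le U V}"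
    by (simp add: pixelation_simps)
next
  fix U V
  assume "U \<in> Ob (pixelation X Y)" "V \<in> Ob (pixelation X Y)" "pixel_le U V"
  then have "pixel_roof U V (U \<union> V)"
    by (auto simp: pixelation_simps intro: pixel_roof_union)
  then have "(path_arr X U (U \<union> V), path_arr X V (U \<union> V)) \<in> pixel_arr U V"
    by (auto simp: pixel_arr_def)
  moreover have "Dom (path_cat X) f = U \<and> Dom (path_cat X) s = V" if "(f, s) \<in> pixel_arr U V" for f s
    using that by (auto simp: pixel_arr_def pixel_roof_def Dom_path_arr)
  ultimately have "(\<lambda>(f, s). Dom (path_cat X) f) ` pixel_arr U V = {U}"
    "(\<lambda>(f, s). Dom (path_cat X) s) ` pixel_arr U V = {V}"
    by (fastforce simp: image_iff)+
  then show "Dom (pixelation X Y) (pixel_arr U V) = U" "Cod (pixelation X Y) (pixel_arr U V) = V"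
    by (simp_all add: pixelation_simps)
next
  fix U
  assume "U \<in> Ob (pixelation X Y)"
  then show "Ident (pixelation X Y) U = pixel_arr U U"
    using fraction_class_path_arr[of U U U]
    by (simp add: pixelation_simps path.Ident_arr Ob_path_cat pixel_roof_def)
next
  fix U V W
  assume "U \<in> Ob (pixelation X Y)" "V \<in> Ob (pixelation X Y)" "W \<in> Ob (pixelation X Y)"
    "pixel_le U V" "pixel_le V W"
  then show "Comp (pixelation X Y) (pixel_arr V W) (pixel_arr U V) = pixel_arr U W"
    by (intro Comp_pixel_arr) (auto simp: pixelation_simps)
qed (auto simp: pixel_le_def)

end

section \<open>The quiver of pixels\<close>

lemma interval_partition_1:
  "interval_partition 1 I \<longleftrightarrow> I 0 \<noteq> {} \<and> I 1 \<noteq> {} \<and> is_interval (I 0) \<and> is_interval (I 1) \<and>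
    I 0 \<union> I 1 = {0..1} \<and> (\<forall>s\<in>I 0. \<forall>t\<in>I 1. s < t)"
proof -
  have all: "(\<forall>i\<le>1. P i) \<longleftrightarrow> P 0 \<and> P 1" for P :: "nat \<Rightarrow> bool"
    by (auto simp: le_Suc_eq)
  have ord: "(\<forall>i j. i < j \<and> j \<le> 1 \<longrightarrow> Q i j) \<longleftrightarrow> Q 0 1" for Q :: "nat \<Rightarrow> nat \<Rightarrow> bool"
    by (auto simp: le_Suc_eq)
  have "{..1::nat} = {0, 1}"
    by auto
  then have un: "(\<Union>i\<le>1. I i) = I 0 \<union> I 1"
    by simp
  show ?thesis
    unfolding interval_partition_def all ord un by argo
qed

text \<open>The point 0 lies in \<open>I 0\<close> and 1 in \<open>I 1\<close>, so the traces of
  \<open>\<gamma> 0\<close> and \<open>\<gamma> 1\<close> differ, and the latter is the trace of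
  \<open>V\<close> because \<open>\<rho>\<close> stays in one pixel. Conversely, a path jumping once
  from \<open>U\<close> to \<open>U \<union> V\<close> crosses exactly two pixels.\<close>

lemma pseudo_arrow_iff:
  assumes "openin X U" "openin X V"
  shows "pseudo_arrow X Y m \<and> Dom (pixelation X Y) m = U \<and> Cod (pixelation X Y) m = V \<longleftrightarrow>
    m = pixel_arr X Y U V \<and> U \<inter> Y \<subset> V \<inter> Y" (is "?L \<longleftrightarrow> ?R")
proof -
  interpret pixelation: thin_category "pixelation X Y" "pixel_le Y" "pixel_arr X Y"
    by (rule thin_pixelation)
  show ?thesis
  proof
    assume L: ?L
    then have "pseudo_arrow X Y m" by simp
    then obtain \<gamma> \<rho> I P P' where paths: "\<gamma> \<in> path_set X" "\<rho> \<in> path_set X" "\<gamma> 1 = \<rho> 1"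
      and \<rho>: "path_class X \<rho> \<in> pixel_arrows X Y"
      and m: "m = fraction_class (path_cat X) (pixel_arrows X Y) (path_class X \<rho>) (path_class X \<gamma>)"
      and I: "interval_partition 1 I"
      and P: "P \<in> pixels X Y" "P' \<in> pixels X Y" "P \<noteq> P'" "\<gamma> ` I 0 \<subseteq> P" "\<gamma> ` I 1 \<subseteq> P'"
      unfolding pseudo_arrow_def by metis
    note ends = path_set_endpoints[OF paths(1)] path_set_endpoints[OF paths(2)]
    have \<rho>Y: "\<rho> 0 \<inter> Y = \<rho> 1 \<inter> Y"
      using \<rho> ends paths by (simp add: path_class_eq path_arr_in_pixel_arrows_iff)
    with ends paths have roof: "pixel_roof X Y (\<gamma> 0) (\<rho> 0) (\<gamma> 1)"
      by (simp add: pixel_roof_def)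
    have m': "m = pixel_arr X Y (\<gamma> 0) (\<rho> 0)"
      using fraction_class_path_arr[OF roof] paths m by (simp add: path_class_eq)
    have le: "pixel_le Y (\<gamma> 0) (\<rho> 0)"
      using roof by (rule pixel_roof_le)
    have eq: "\<gamma> 0 = U" "\<rho> 0 = V"
      using L m' le ends by (simp_all add: pixelation.Dom_arr pixelation.Cod_arr pixelation_simps(1))
    have cover: "I 0 \<union> I 1 = {0..1}" and ne: "I 0 \<noteq> {}" "I 1 \<noteq> {}"
      and less: "\<forall>s\<in>I 0. \<forall>t\<in>I 1. s < t"
      using I unfolding interval_partition_1 by blast+
    \<comment> \<open>Otherwise the elements of \<open>I 0\<close> would be negative, outside the
      unit interval.\<close>
    have "0 \<notin> I 1"
    proof
      assume "0 \<in> I 1"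
      moreover obtain t where "t \<in> I 0" using ne by blast
      ultimately show False using less cover by fastforce
    qed
    moreover have "1 \<notin> I 0"
    proof
      assume "1 \<in> I 0"
      moreover obtain t where "t \<in> I 1" using ne by blast
      ultimately show False using less cover by fastforce
    qed
    ultimately have "0 \<in> I 0" "1 \<in> I 1"
      using cover by auto
    then have "\<gamma> 0 \<in> P" "\<gamma> 1 \<in> P'"
      using P by auto
    then have "P = pixel X Y (\<gamma> 0 \<inter> Y)" "P' = pixel X Y (\<gamma> 1 \<inter> Y)"
      using pixels_eq_pixel[OF P(1)] pixels_eq_pixel[OF P(2)] by simp_all
    then have "\<gamma> 0 \<inter> Y \<noteq> \<gamma> 1 \<inter> Y"
      using P(3) by auto
    then show ?R
      using m' eq le \<rho>Y paths by (auto simp: pixel_le_def)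
  next
    assume R: ?R
    let ?W = "U \<union> V"
    define \<gamma> where "\<gamma> = step_path (1/2) (1/2) U ?W ?W"
    define \<rho> where "\<rho> = step_path (1/2) (1/2) V ?W ?W"
    \<comment> \<open>The cut point belongs to the second piece, as the step path with
      \<open>c = 1/2\<close> has already left \<open>U\<close> at 1/2.\<close>
    define I :: "nat \<Rightarrow> real set" where "I i = (if i = 0 then {0..<1/2} else {1/2..1})" for i
    have le: "pixel_le Y U V" using R by (auto simp: pixel_le_def)
    then have roof: "pixel_roof X Y U V ?W"
      using assms by (intro pixel_roof_union)
    have "\<gamma> \<in> path_arr X U ?W" "\<rho> \<in> path_arr X V ?W"
      using assms unfolding \<gamma>_def \<rho>_def by (auto intro!: step_path_in_path_arr)
    then have paths: "\<gamma> \<in> path_set X" "\<rho> \<in> path_set X" "\<gamma> 1 = \<rho> 1"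
      and cls: "path_class X \<gamma> = path_arr X U ?W" "path_class X \<rho> = path_arr X V ?W"
      by (simp_all add: path_arr_def path_class_eq)
    have "path_class X \<rho> \<in> pixel_arrows X Y"
      using roof unfolding cls pixel_roof_def by (intro path_arr_in_pixel_arrows_iff[THEN iffD2]) auto
    moreover have "m = fraction_class (path_cat X) (pixel_arrows X Y) (path_class X \<rho>) (path_class X \<gamma>)"
      using R fraction_class_path_arr[OF roof] unfolding cls by simp
    moreover have "interval_partition 1 I"
      unfolding interval_partition_1 I_def by (auto simp: is_interval_cc is_interval_co)
    moreover have "pixel X Y (U \<inter> Y) \<in> pixels X Y" "pixel X Y (?W \<inter> Y) \<in> pixels X Y"
      using assms by (auto intro!: pixel_in_pixels)
    \<comment> \<open>The set \<open>U\<close> itself separates them: \<open>?W\<close> has the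
      trace of \<open>V\<close>, which is strictly larger.\<close>
    moreover have "pixel X Y (U \<inter> Y) \<noteq> pixel X Y (?W \<inter> Y)"
      using R assms by (auto simp: pixel_def)
    moreover have "\<gamma> ` I 0 \<subseteq> pixel X Y (U \<inter> Y)" "\<gamma> ` I 1 \<subseteq> pixel X Y (?W \<inter> Y)"
      using assms by (auto simp: \<gamma>_def I_def step_path_def pixel_def)
    ultimately have "pseudo_arrow X Y m"
      using paths unfolding pseudo_arrow_def by blast
    then show ?L
      using R assms le by (simp add: pixelation.Dom_arr pixelation.Cod_arr pixelation_simps(1))
  qed
qed

section \<open>Walks in the quiver and the quotient of the free category\<close>

context
  fixes X :: "'a topology" and Y :: "'a set" and s :: "'a set set \<Rightarrow> 'a set"
  assumes choice: "pixel_choice X Y s"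
begin

interpretation pixelation: thin_category "pixelation X Y" "pixel_le Y" "pixel_arr X Y"
  by (rule thin_pixelation)

interpretation quiver: pre_digraph "pixel_quiver X Y s" .

lemma choice_open: "P \<in> pixels X Y \<Longrightarrow> openin X (s P)"
  and choice_pixel: "P \<in> pixels X Y \<Longrightarrow> pixel X Y (s P \<inter> Y) = P"
  using choice pixels_eq_pixel unfolding pixel_choice_def by metis+

lemma choice_of_pixel: "pixel X Y Z \<in> pixels X Y \<Longrightarrow> s (pixel X Y Z) \<inter> Y = Z"
  using choice by (auto simp: pixel_choice_def pixel_def)

text \<open>By \<open>pseudo_arrow_iff\<close> the middle component is determined by the endpoints,
  so at most one arc joins two given pixels.\<close>

lemma in_arcs_iff:
  "(P, m, P') \<in> arcs (pixel_quiver X Y s) \<longleftrightarrow>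
    P \<in> pixels X Y \<and> P' \<in> pixels X Y \<and> m = pixel_arr X Y (s P) (s P') \<and> s P \<inter> Y \<subset> s P' \<inter> Y"
  using pseudo_arrow_iff[of X "s P" "s P'" Y m] choice_open[of P] choice_open[of P']
  by (auto simp: pixel_quiver_def)

lemma quiver_simps:
  "verts (pixel_quiver X Y s) = pixels X Y"
  "tail (pixel_quiver X Y s) (P, m, P') = P"
  "head (pixel_quiver X Y s) (P, m, P') = P'"
  by (simp_all add: pixel_quiver_def)

definition pixel_walks where
  "pixel_walks P P' = {(P, p, P') | p. quiver.awalk P p P'}"

text \<open>By induction along the walk: \<open>\<Psi>\<close> composes arrows of a thin category,
  so its value depends on the endpoints alone. This is what identifies all parallel walks.\<close>

lemma awalk_extension:
  assumes "quiver.awalk P p P'"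
  shows "P \<in> pixels X Y \<and> P' \<in> pixels X Y \<and> pixel_le Y (s P) (s P') \<and>
    free_extension (pixelation X Y) s (\<lambda>(P, m, P'). m) (P, p, P') = pixel_arr X Y (s P) (s P')"
  using assms
proof (induction p arbitrary: P)
  case Nil
  then show ?case
    by (auto simp: quiver.awalk_def quiver_simps free_extension_def pixelation.Ident_arr
        pixelation_simps(1) choice_open pixel_le_def)
next
  case (Cons e p)
  obtain P1 m P2 where e: "e = (P1, m, P2)" by (cases e)
  with Cons.prems have arc: "(P, m, P2) \<in> arcs (pixel_quiver X Y s)" and "P1 = P"
    and cas: "set p \<subseteq> arcs (pixel_quiver X Y s)" "quiver.cas P2 p P'"
    by (auto simp: quiver.awalk_def quiver_simps)
  have P: "P \<in> pixels X Y" "P2 \<in> pixels X Y" "m = pixel_arr X Y (s P) (s P2)"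
    "pixel_le Y (s P) (s P2)"
    using arc by (auto simp: in_arcs_iff pixel_le_def)
  then have IH: "P' \<in> pixels X Y" "pixel_le Y (s P2) (s P')"
    "compose_list (pixelation X Y) (s P2) (map (\<lambda>(P, m, P'). m) p) = pixel_arr X Y (s P2) (s P')"
    using Cons.IH[of P2] cas by (simp_all add: quiver.awalk_def quiver_simps free_extension_def)
  have "pixel_le Y (s P) (s P')"
    using IH P by (auto simp: pixel_le_def)
  then show ?case
    using P IH e by (simp add: free_extension_def pixelation.Cod_arr pixelation.Comp_arr
        pixelation_simps(1) choice_open)
qed

text \<open>A single arc suffices if the traces differ; if they agree, the pixels coincide and the
  empty walk does.\<close>

lemma awalk_exists:
  assumes "P \<in> pixels X Y" "P' \<in> pixels X Y" "pixel_le Y (s P) (s P')"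
  shows "\<exists>p. quiver.awalk P p P'"
proof (cases "s P \<inter> Y = s P' \<inter> Y")
  case True
  then have "P = P'"
    using assms choice_pixel by metis
  then have "quiver.awalk P [] P'"
    using assms by (simp add: quiver.awalk_def quiver_simps)
  then show ?thesis ..
next
  case False
  then have "(P, pixel_arr X Y (s P) (s P'), P') \<in> arcs (pixel_quiver X Y s)"
    using assms by (auto simp: in_arcs_iff pixel_le_def)
  then have "quiver.awalk P [(P, pixel_arr X Y (s P) (s P'), P')] P'"
    using assms by (simp add: quiver.awalk_def quiver_simps)
  then show ?thesis ..
qed

lemma awalk_append:
  assumes "quiver.awalk P p Q" "quiver.awalk Q q R"
  shows "quiver.awalk P (p @ q) R"
proof -
  have "quiver.cas P (p @ q) R" if "quiver.cas P p Q" for P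
    using that assms(2) by (induction p arbitrary: P) (auto simp: quiver.awalk_def)
  then show ?thesis
    using assms by (simp add: quiver.awalk_def)
qed

lemma free_cat_simps:
  "Ob (free_cat (pixel_quiver X Y s)) = pixels X Y"
  "(P, p, P') \<in> Ar (free_cat (pixel_quiver X Y s)) \<longleftrightarrow> quiver.awalk P p P'"
  "Dom (free_cat (pixel_quiver X Y s)) (P, p, P') = P"
  "Cod (free_cat (pixel_quiver X Y s)) (P, p, P') = P'"
  "Ident (free_cat (pixel_quiver X Y s)) P = (P, [], P)"
  "Comp (free_cat (pixel_quiver X Y s)) (Q, q, Q') (P, p, P') = (P, p @ q, Q')"
  by (simp_all add: free_cat_def quiver_simps)

text \<open>Equality under \<open>\<Psi>\<close> is automatic by \<open>awalk_extension\<close>, so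
  only endpoints are left to compare.\<close>

lemma pixel_rel_class:
  assumes "quiver.awalk P p P'"
  shows "pixel_rel X Y s `` {(P, p, P')} = pixel_walks P P'"
proof -
  have "((P, p, P'), (Q, q, Q')) \<in> pixel_rel X Y s \<longleftrightarrow> quiver.awalk Q q Q' \<and> Q = P \<and> Q' = P'" for Q q Q'
    using assms awalk_extension[of P p P'] awalk_extension[of P q P']
    unfolding pixel_rel_def mem_Collect_eq prod.case free_cat_simps by metis
  then show ?thesis
    by (auto simp: pixel_walks_def)
qed

lemma thin_pixel_quiver_cat:
  "thin_category (pixel_quiver_cat X Y s) (\<lambda>P P'. pixel_le Y (s P) (s P')) pixel_walks"
proof
  show "Ar (pixel_quiver_cat X Y s) = {pixel_walks P P' | P P'. P \<in> Ob (pixel_quiver_cat X Y s) \<and>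
      P' \<in> Ob (pixel_quiver_cat X Y s) \<and> pixel_le Y (s P) (s P')}" (is "?L = ?R")
  proof
    show "?L \<subseteq> ?R"
    proof
      fix c
      assume "c \<in> ?L"
      then obtain P p P' where "quiver.awalk P p P'" "c = pixel_rel X Y s `` {(P, p, P')}"
        by (auto simp: pixel_quiver_cat_def quotient_cat_def quotient_def free_cat_simps)
      then show "c \<in> ?R"
        using awalk_extension[of P p P'] pixel_rel_class
        by (auto simp: pixel_quiver_cat_def quotient_cat_def free_cat_simps)
    qed
    show "?R \<subseteq> ?L"
    proof
      fix c
      assume "c \<in> ?R"
      then obtain P P' where c: "c = pixel_walks P P'" "P \<in> pixels X Y" "P' \<in> pixels X Y"
        "pixel_le Y (s P) (s P')"
        by (auto simp: pixel_quiver_cat_def quotient_cat_def free_cat_simps)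
      then obtain p where p: "quiver.awalk P p P'"
        using awalk_exists by blast
      then have "c = pixel_rel X Y s `` {(P, p, P')}"
        using pixel_rel_class c by simp
      then show "c \<in> ?L"
        using p by (auto simp: pixel_quiver_cat_def quotient_cat_def free_cat_simps intro!: quotientI)
    qed
  qed
next
  fix P P'
  assume "P \<in> Ob (pixel_quiver_cat X Y s)" "P' \<in> Ob (pixel_quiver_cat X Y s)"
    "pixel_le Y (s P) (s P')"
  then have "pixel_walks P P' \<noteq> {}"
    using awalk_exists
    by (auto simp: pixel_walks_def pixel_quiver_cat_def quotient_cat_def free_cat_simps)
  then have "Dom (free_cat (pixel_quiver X Y s)) ` pixel_walks P P' = {P}"
    "Cod (free_cat (pixel_quiver X Y s)) ` pixel_walks P P' = {P'}"
    by (auto simp: pixel_walks_def free_cat_simps image_iff)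
  then show "Dom (pixel_quiver_cat X Y s) (pixel_walks P P') = P"
    "Cod (pixel_quiver_cat X Y s) (pixel_walks P P') = P'"
    by (simp_all add: pixel_quiver_cat_def quotient_cat_def)
next
  fix P
  assume "P \<in> Ob (pixel_quiver_cat X Y s)"
  then have "quiver.awalk P [] P"
    by (simp add: quiver.awalk_def quiver_simps pixel_quiver_cat_def quotient_cat_def free_cat_simps)
  then show "Ident (pixel_quiver_cat X Y s) P = pixel_walks P P"
    using pixel_rel_class[of P "[]" P]
    by (simp add: pixel_quiver_cat_def quotient_cat_def free_cat_simps)
next
  fix P Q R
  assume PQR: "P \<in> Ob (pixel_quiver_cat X Y s)" "Q \<in> Ob (pixel_quiver_cat X Y s)"
    "R \<in> Ob (pixel_quiver_cat X Y s)" "pixel_le Y (s P) (s Q)" "pixel_le Y (s Q) (s R)"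
  \<comment> \<open>Every choice of representatives composes to the same class, so the union
    defining \<open>Comp\<close> equals that class as soon as both arrows are nonempty sets of
    walks.\<close>
  have comp: "pixel_rel X Y s `` {Comp (free_cat (pixel_quiver X Y s)) g f} = pixel_walks P R"
    if fg: "f \<in> pixel_walks P Q" "g \<in> pixel_walks Q R" for f g
  proof -
    obtain p q where "f = (P, p, Q)" "g = (Q, q, R)" "quiver.awalk P p Q" "quiver.awalk Q q R"
      using fg by (auto simp: pixel_walks_def)
    then show ?thesis
      using pixel_rel_class[OF awalk_append] by (simp add: free_cat_simps)
  qed
  have "pixel_walks P Q \<noteq> {}" "pixel_walks Q R \<noteq> {}"
    using PQR awalk_exists
    by (auto simp: pixel_walks_def pixel_quiver_cat_def quotient_cat_def free_cat_simps)
  then show "Comp (pixel_quiver_cat X Y s) (pixel_walks Q R) (pixel_walks P Q) = pixel_walks P R"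
    using comp by (simp add: pixel_quiver_cat_def quotient_cat_def)
qed (auto simp: pixel_le_def)

text \<open>The pixel of \<open>Z\<close> is nonempty exactly when \<open>Z\<close> is the trace of
  an open set, that is, open in the subspace; \<open>Z\<close> is recovered as the trace of any
  member.\<close>

lemma bij_betw_pixel:
  "bij_betw (pixel X Y) {Z. openin (subtopology X Y) Z} (Ob (pixel_quiver_cat X Y s))"
proof -
  have "inj_on (pixel X Y) {Z. openin (subtopology X Y) Z}"
    by (rule inj_onI) (auto simp: pixel_def openin_subtopology)
  moreover have "pixel X Y ` {Z. openin (subtopology X Y) Z} = pixels X Y"
    by (auto simp: pixels_def pixel_def openin_subtopology)
  ultimately show ?thesis
    by (simp add: bij_betw_def pixel_quiver_cat_def quotient_cat_def free_cat_simps)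
qed

text \<open>The map \<open>h\<close> lets both claims share one argument: it is the identity for a
  subspace, and the image under contraction for a local ring.\<close>

lemma pixel_quiver_cat_iso:
  assumes bij: "bij_betw h {W. openin T W} {Z. openin (subtopology X Y) Z}"
    and mono: "\<And>V W. \<lbrakk>openin T V; openin T W\<rbrakk> \<Longrightarrow> h V \<subseteq> h W \<longleftrightarrow> V \<subseteq> W"
  shows "\<exists>F. category_iso (top_cat T) (pixel_quiver_cat X Y s) (\<lambda>W. pixel X Y (h W)) F"
proof -
  have "bij_betw (\<lambda>W. pixel X Y (h W)) (Ob (top_cat T)) (Ob (pixel_quiver_cat X Y s))"
    using bij_betw_trans[OF bij bij_betw_pixel] by (simp add: top_cat_def comp_def)
  \<comment> \<open>Whatever object is chosen in the pixel of \<open>h W\<close>, its trace is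
    \<open>h W\<close>; comparing chosen objects by \<open>pixel_le\<close> therefore compares the
    sets \<open>h W\<close>.\<close>
  moreover have "s (pixel X Y (h W)) \<inter> Y = h W" if "openin T W" for W
  proof -
    have "openin (subtopology X Y) (h W)"
      using bij that by (auto simp: bij_betw_def)
    then show ?thesis
      using pixel_in_pixels by (intro choice_of_pixel) (auto simp: openin_subtopology)
  qed
  ultimately have "category_iso (top_cat T) (pixel_quiver_cat X Y s) (\<lambda>W. pixel X Y (h W))
      (\<lambda>f. pixel_walks (pixel X Y (h (Dom (top_cat T) f))) (pixel X Y (h (Cod (top_cat T) f))))"
    by (intro thin_category_iso[OF thin_top_cat thin_pixel_quiver_cat])
      (auto simp: pixel_le_def top_cat_def mono)
  then show ?thesis
    by blast
qed

end

section \<open>Spectrum of a localisation\<close>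

lemma zariski_subset_Spec: "openin (zariski A) W \<Longrightarrow> W \<subseteq> Spec A"
  by (auto simp: openin_zariski)

text \<open>Fractions are treated for an arbitrary multiplicative set; the complement of a prime
  ideal is substituted only at the end.\<close>

locale multiplicative_set = cring R for R (structure) +
  fixes S
  assumes S_subset: "S \<subseteq> carrier R"
    and one_in_S: "\<one> \<in> S"
    and mult_in_S: "\<lbrakk>s \<in> S; t \<in> S\<rbrakk> \<Longrightarrow> s \<otimes> t \<in> S"
begin

abbreviation loc where "loc \<equiv> localization R S"

definition frac where "frac a s = localization_rel R S `` {(a, s)}"

lemma S_carrier: "s \<in> S \<Longrightarrow> s \<in> carrier R"
  using S_subset by blast

text \<open>Replacing a vanishing difference by an equation of products removes subtraction from all
  later comparisons of fractions.\<close>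

lemma localization_rel_iff:
  "((a, s), (b, t)) \<in> localization_rel R S \<longleftrightarrow>
    a \<in> carrier R \<and> b \<in> carrier R \<and> s \<in> S \<and> t \<in> S \<and> (\<exists>u\<in>S. u \<otimes> (a \<otimes> t) = u \<otimes> (b \<otimes> s))"
proof -
  have "u \<otimes> (a \<otimes> t \<ominus> b \<otimes> s) = \<zero> \<longleftrightarrow> u \<otimes> (a \<otimes> t) = u \<otimes> (b \<otimes> s)"
    if "a \<in> carrier R" "b \<in> carrier R" "s \<in> S" "t \<in> S" "u \<in> S" for u
  proof -
    have "u \<otimes> (a \<otimes> t \<ominus> b \<otimes> s) = u \<otimes> (a \<otimes> t) \<ominus> u \<otimes> (b \<otimes> s)"
      using that by (simp add: minus_eq r_distr r_minus S_carrier)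
    then show ?thesis
      using that by (simp add: S_carrier)
  qed
  then show ?thesis
    by (auto simp: localization_rel_def)
qed

lemma equiv_localization_rel: "equiv (carrier R \<times> S) (localization_rel R S)"
proof (rule equivI)
  show "localization_rel R S \<subseteq> (carrier R \<times> S) \<times> carrier R \<times> S"
    by (auto simp: localization_rel_iff)
  show "refl_on (carrier R \<times> S) (localization_rel R S)"
    using one_in_S by (auto simp: refl_on_def localization_rel_iff)
  show "sym (localization_rel R S)"
    by (rule symI) (auto simp: localization_rel_iff eq_commute)
  show "trans (localization_rel R S)"
  proof (rule transI, clarify)
    fix a s b t c r
    assume "((a, s), (b, t)) \<in> localization_rel R S" "((b, t), (c, r)) \<in> localization_rel R S"
    then obtain u v where in_S: "s \<in> S" "t \<in> S" "r \<in> S" "u \<in> S" "v \<in> S"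
      and abc: "a \<in> carrier R" "b \<in> carrier R" "c \<in> carrier R"
      and u: "u \<otimes> (a \<otimes> t) = u \<otimes> (b \<otimes> s)" and v: "v \<otimes> (b \<otimes> r) = v \<otimes> (c \<otimes> t)"
      by (auto simp: localization_rel_iff)
    note carr = in_S[THEN S_carrier] abc
    \<comment> \<open>The factor \<open>t\<close> in the witness
      \<open>u \<otimes> v \<otimes> t\<close> allows both given equations to be applied in
      turn.\<close>
    have "(u \<otimes> v \<otimes> t) \<otimes> (a \<otimes> r) = (u \<otimes> (a \<otimes> t)) \<otimes> (v \<otimes> r)"
      using carr by (simp add: m_ac)
    also have "\<dots> = (v \<otimes> (b \<otimes> r)) \<otimes> (u \<otimes> s)"
      unfolding u using carr by (simp add: m_ac)
    also have "\<dots> = (u \<otimes> v \<otimes> t) \<otimes> (c \<otimes> s)"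
      unfolding v using carr by (simp add: m_ac)
    finally show "((a, s), (c, r)) \<in> localization_rel R S"
      using in_S abc mult_in_S by (auto simp: localization_rel_iff)
  qed
qed

lemma frac_eq_iff:
  assumes "a \<in> carrier R" "b \<in> carrier R" "s \<in> S" "t \<in> S"
  shows "frac a s = frac b t \<longleftrightarrow> (\<exists>u\<in>S. u \<otimes> (a \<otimes> t) = u \<otimes> (b \<otimes> s))"
  using eq_equiv_class_iff[OF equiv_localization_rel, of "(a, s)" "(b, t)"] assms
  by (simp add: frac_def localization_rel_iff)

lemma in_frac_iff:
  assumes "a \<in> carrier R" "s \<in> S"
  shows "(b, t) \<in> frac a s \<longleftrightarrow> b \<in> carrier R \<and> t \<in> S \<and> frac b t = frac a s"
proof -
  have "(b, t) \<in> frac a s \<longleftrightarrow> ((a, s), (b, t)) \<in> localization_rel R S"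
    by (simp add: frac_def)
  then show ?thesis
    using assms frac_eq_iff[of a b s t] by (auto simp: localization_rel_iff)
qed

lemma frac_cong:
  assumes "a \<in> carrier R" "b \<in> carrier R" "s \<in> S" "t \<in> S" "u \<in> S"
    and "u \<otimes> (a \<otimes> t) = u \<otimes> (b \<otimes> s)"
  shows "frac a s = frac b t"
  using assms frac_eq_iff by blast

lemma frac_cancel:
  assumes "a \<in> carrier R" "s \<in> S" "u \<in> S"
  shows "frac (a \<otimes> u) (s \<otimes> u) = frac a s"
  using assms one_in_S by (intro frac_cong[of _ _ _ _ \<one>]) (auto simp: m_ac S_carrier mult_in_S)

section \<open>The ring structure on fractions\<close>

lemma carrier_loc: "carrier loc = {frac a s | a s. a \<in> carrier R \<and> s \<in> S}"
  by (auto simp: localization_def quotient_def frac_def)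

lemma frac_in_carrier: "\<lbrakk>a \<in> carrier R; s \<in> S\<rbrakk> \<Longrightarrow> frac a s \<in> carrier loc"
  using carrier_loc by blast

lemma one_loc: "\<one>\<^bsub>loc\<^esub> = frac \<one> \<one>" and zero_loc: "\<zero>\<^bsub>loc\<^esub> = frac \<zero> \<one>"
  by (simp_all add: localization_def frac_def)

text \<open>A well-definedness principle for operations given as unions over representatives: a
  contribution that does not depend on them equals the union, since \<open>(a, s)\<close> and
  \<open>(b, t)\<close> themselves occur.\<close>

lemma UN_frac:
  assumes "a \<in> carrier R" "b \<in> carrier R" "s \<in> S" "t \<in> S"
    and "\<And>a' s' b' t' u v. \<lbrakk>a' \<in> carrier R; b' \<in> carrier R; s' \<in> S; t' \<in> S; u \<in> S; v \<in> S;
      u \<otimes> (a' \<otimes> s) = u \<otimes> (a \<otimes> s'); v \<otimes> (b' \<otimes> t) = v \<otimes> (b \<otimes> t')\<rbrakk> \<Longrightarrow> g a' s' b' t' = c"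
  shows "(\<Union>(a', s')\<in>frac a s. \<Union>(b', t')\<in>frac b t. g a' s' b' t') = c"
proof -
  have "g a' s' b' t' = c" if "(a', s') \<in> frac a s" "(b', t') \<in> frac b t" for a' s' b' t'
    using that assms by (auto simp: in_frac_iff frac_eq_iff)
  moreover have "(a, s) \<in> frac a s" "(b, t) \<in> frac b t"
    using assms by (simp_all add: in_frac_iff)
  ultimately show ?thesis
    by (fastforce split: prod.splits)
qed

lemma mult_frac:
  assumes ab: "a \<in> carrier R" "b \<in> carrier R" and st: "s \<in> S" "t \<in> S"
  shows "frac a s \<otimes>\<^bsub>loc\<^esub> frac b t = frac (a \<otimes> b) (s \<otimes> t)"
  unfolding localization_def monoid.simps frac_def[symmetric]
proof (rule UN_frac[OF ab st])
  fix a' s' b' t' u v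
  assume ab': "a' \<in> carrier R" "b' \<in> carrier R" and in_S: "s' \<in> S" "t' \<in> S" "u \<in> S" "v \<in> S"
    and u: "u \<otimes> (a' \<otimes> s) = u \<otimes> (a \<otimes> s')" and v: "v \<otimes> (b' \<otimes> t) = v \<otimes> (b \<otimes> t')"
  note carr = ab ab' st[THEN S_carrier] in_S[THEN S_carrier]
  have "(u \<otimes> v) \<otimes> ((a' \<otimes> b') \<otimes> (s \<otimes> t)) = (u \<otimes> (a' \<otimes> s)) \<otimes> (v \<otimes> (b' \<otimes> t))"
    using carr by (simp add: m_ac)
  also have "\<dots> = (u \<otimes> v) \<otimes> ((a \<otimes> b) \<otimes> (s' \<otimes> t'))"
    unfolding u v using carr by (simp add: m_ac)
  finally show "frac (a' \<otimes> b') (s' \<otimes> t') = frac (a \<otimes> b) (s \<otimes> t)"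
    using ab ab' st in_S by (intro frac_cong[of _ _ _ _ "u \<otimes> v"]) (auto intro: mult_in_S)
qed

lemma add_frac:
  assumes ab: "a \<in> carrier R" "b \<in> carrier R" and st: "s \<in> S" "t \<in> S"
  shows "frac a s \<oplus>\<^bsub>loc\<^esub> frac b t = frac (a \<otimes> t \<oplus> b \<otimes> s) (s \<otimes> t)"
  unfolding localization_def ring.simps frac_def[symmetric]
proof (rule UN_frac[OF ab st])
  fix a' s' b' t' u v
  assume ab': "a' \<in> carrier R" "b' \<in> carrier R" and in_S: "s' \<in> S" "t' \<in> S" "u \<in> S" "v \<in> S"
    and u: "u \<otimes> (a' \<otimes> s) = u \<otimes> (a \<otimes> s')" and v: "v \<otimes> (b' \<otimes> t) = v \<otimes> (b \<otimes> t')"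
  note carr = ab ab' st[THEN S_carrier] in_S[THEN S_carrier]
  \<comment> \<open>Regrouping exposes the left side of the equation for \<open>u\<close> in the
    first summand and of that for \<open>v\<close> in the second.\<close>
  have "(u \<otimes> v) \<otimes> ((a' \<otimes> t' \<oplus> b' \<otimes> s') \<otimes> (s \<otimes> t)) =
      (u \<otimes> (a' \<otimes> s)) \<otimes> (v \<otimes> (t' \<otimes> t)) \<oplus> (v \<otimes> (b' \<otimes> t)) \<otimes> (u \<otimes> (s' \<otimes> s))"
    using carr by (simp add: m_ac r_distr l_distr)
  also have "\<dots> = (u \<otimes> v) \<otimes> ((a \<otimes> t \<oplus> b \<otimes> s) \<otimes> (s' \<otimes> t'))"
    unfolding u v using carr by (simp add: m_ac r_distr l_distr)
  finally show "frac (a' \<otimes> t' \<oplus> b' \<otimes> s') (s' \<otimes> t') = frac (a \<otimes> t \<oplus> b \<otimes> s) (s \<otimes> t)"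
    using ab ab' st in_S
    by (intro frac_cong[of _ _ _ _ "u \<otimes> v"]) (auto intro: mult_in_S simp: S_carrier)
qed

lemma frac_zero: "s \<in> S \<Longrightarrow> frac \<zero> s = \<zero>\<^bsub>loc\<^esub>"
  unfolding zero_loc using one_in_S by (intro frac_cong[of _ _ _ _ \<one>]) (auto simp: S_carrier)

lemma loc_cases:
  assumes "x \<in> carrier loc"
  obtains a s where "a \<in> carrier R" "s \<in> S" "x = frac a s"
  using assms carrier_loc by auto

lemmas loc_simps = mult_frac add_frac mult_in_S S_carrier frac_in_carrier one_in_S

lemma cring_loc: "cring loc"
proof (rule cringI)
  show "abelian_group loc"
  proof (rule abelian_groupI)
    fix x y z
    assume "x \<in> carrier loc" "y \<in> carrier loc" "z \<in> carrier loc"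
    then show "x \<oplus>\<^bsub>loc\<^esub> y \<oplus>\<^bsub>loc\<^esub> z = x \<oplus>\<^bsub>loc\<^esub> (y \<oplus>\<^bsub>loc\<^esub> z)"
      by (elim loc_cases) (simp add: loc_simps l_distr r_distr m_ac a_ac)
  next
    fix x
    assume "x \<in> carrier loc"
    then obtain a s where x: "a \<in> carrier R" "s \<in> S" "x = frac a s"
      by (rule loc_cases)
    then show "\<zero>\<^bsub>loc\<^esub> \<oplus>\<^bsub>loc\<^esub> x = x"
      by (simp add: zero_loc loc_simps)
    have "frac (\<ominus> a) s \<oplus>\<^bsub>loc\<^esub> x = frac ((\<ominus> a \<oplus> a) \<otimes> s) (s \<otimes> s)"
      using x unfolding l_distr[OF a_inv_closed[OF x(1)] x(1) S_carrier[OF x(2)]]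
      by (simp add: loc_simps)
    also have "\<dots> = \<zero>\<^bsub>loc\<^esub>"
      using x by (simp add: l_neg loc_simps frac_zero)
    finally show "\<exists>y\<in>carrier loc. y \<oplus>\<^bsub>loc\<^esub> x = \<zero>\<^bsub>loc\<^esub>"
      using x frac_in_carrier[of "\<ominus> a" s] by blast
  next
    fix x y
    assume "x \<in> carrier loc" "y \<in> carrier loc"
    then show "x \<oplus>\<^bsub>loc\<^esub> y = y \<oplus>\<^bsub>loc\<^esub> x" "x \<oplus>\<^bsub>loc\<^esub> y \<in> carrier loc"
      by (elim loc_cases, simp add: loc_simps m_comm a_comm)+
  qed (simp add: zero_loc loc_simps)
  show "comm_monoid loc"
  proof (rule comm_monoidI)
    fix x y z
    assume "x \<in> carrier loc" "y \<in> carrier loc" "z \<in> carrier loc"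
    then show "x \<otimes>\<^bsub>loc\<^esub> y \<otimes>\<^bsub>loc\<^esub> z = x \<otimes>\<^bsub>loc\<^esub> (y \<otimes>\<^bsub>loc\<^esub> z)"
      by (elim loc_cases) (simp add: loc_simps m_assoc)
  next
    fix x y
    assume "x \<in> carrier loc" "y \<in> carrier loc"
    then show "x \<otimes>\<^bsub>loc\<^esub> y = y \<otimes>\<^bsub>loc\<^esub> x" "x \<otimes>\<^bsub>loc\<^esub> y \<in> carrier loc"
      by (elim loc_cases, simp add: loc_simps m_comm)+
  next
    fix x
    assume "x \<in> carrier loc"
    then show "\<one>\<^bsub>loc\<^esub> \<otimes>\<^bsub>loc\<^esub> x = x"
      by (elim loc_cases) (simp add: loc_simps one_loc)
  qed (simp add: one_loc loc_simps)
  fix x y z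
  assume "x \<in> carrier loc" "y \<in> carrier loc" "z \<in> carrier loc"
  then obtain a s b t c r where carr: "a \<in> carrier R" "b \<in> carrier R" "c \<in> carrier R"
    and in_S: "s \<in> S" "t \<in> S" "r \<in> S"
    and xyz: "x = frac a s" "y = frac b t" "z = frac c r"
    by (elim loc_cases)
  \<comment> \<open>Adding over the denominators \<open>s \<otimes> r\<close> and
    \<open>t \<otimes> r\<close> leaves a spare factor \<open>r\<close> above and below, which
    \<open>frac_cancel\<close> removes.\<close>
  have "x \<otimes>\<^bsub>loc\<^esub> z \<oplus>\<^bsub>loc\<^esub> y \<otimes>\<^bsub>loc\<^esub> z =
      frac (((a \<otimes> t \<oplus> b \<otimes> s) \<otimes> c) \<otimes> r) (((s \<otimes> t) \<otimes> r) \<otimes> r)"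
    unfolding xyz using carr in_S by (simp add: loc_simps l_distr r_distr m_ac)
  also have "\<dots> = frac ((a \<otimes> t \<oplus> b \<otimes> s) \<otimes> c) ((s \<otimes> t) \<otimes> r)"
    using carr in_S by (intro frac_cancel) (auto simp: loc_simps)
  also have "\<dots> = (x \<oplus>\<^bsub>loc\<^esub> y) \<otimes>\<^bsub>loc\<^esub> z"
    unfolding xyz using carr in_S by (simp add: loc_simps)
  finally show "(x \<oplus>\<^bsub>loc\<^esub> y) \<otimes>\<^bsub>loc\<^esub> z = x \<otimes>\<^bsub>loc\<^esub> z \<oplus>\<^bsub>loc\<^esub> y \<otimes>\<^bsub>loc\<^esub> z" ..
qed

interpretation loc: cring loc
  by (rule cring_loc)

lemma ring_hom_frac: "ring_hom_ring R loc (\<lambda>a. frac a \<one>)"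
  by (rule ring_hom_ringI)
    (simp_all add: loc_simps one_loc ring_axioms loc.ring_axioms)

section \<open>Contraction and extension of prime ideals\<close>

definition contraction where "contraction \<qq> = {a \<in> carrier R. frac a \<one> \<in> \<qq>}"

definition extension where "extension \<pp> = {frac a s | a s. a \<in> \<pp> \<and> s \<in> S}"

text \<open>The fractions \<open>a/s\<close> and \<open>a/1\<close> are multiples of each other, by
  \<open>s/1\<close> and \<open>1/s\<close>, so an ideal contains both or neither.\<close>

lemma frac_in_prime_iff:
  assumes \<qq>: "primeideal \<qq> loc" and "a \<in> carrier R" "s \<in> S"
  shows "frac a s \<in> \<qq> \<longleftrightarrow> a \<in> contraction \<qq>"
proof -
  interpret \<qq>: primeideal \<qq> loc by fact
  have "frac a s \<otimes>\<^bsub>loc\<^esub> frac s \<one> = frac (a \<otimes> s) (\<one> \<otimes> s)"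
    using assms by (simp add: loc_simps)
  also have "\<dots> = frac a \<one>"
    using assms by (intro frac_cancel) (auto simp: loc_simps)
  finally have 1: "frac a s \<otimes>\<^bsub>loc\<^esub> frac s \<one> = frac a \<one>" .
  have 2: "frac a \<one> \<otimes>\<^bsub>loc\<^esub> frac \<one> s = frac a s"
    using assms by (simp add: loc_simps)
  show ?thesis
    using 1 2 \<qq>.I_r_closed[of "frac a s" "frac s \<one>"] \<qq>.I_r_closed[of "frac a \<one>" "frac \<one> s"] assms
    by (auto simp: contraction_def loc_simps)
qed

text \<open>Primes pull back to primes along a ring homomorphism; an element \<open>s\<close> of
  \<open>S\<close> in the contraction would put \<open>s/s = 1\<close> into
  \<open>\<qq>\<close>.\<close>

lemma contraction_prime:
  assumes "primeideal \<qq> loc"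
  shows "primeideal (contraction \<qq>) R" and "contraction \<qq> \<inter> S = {}"
proof -
  interpret \<qq>: primeideal \<qq> loc by fact
  show "primeideal (contraction \<qq>) R"
    unfolding contraction_def
    by (rule ring_hom_ring.primeideal_vimage[OF ring_hom_frac is_cring assms])
  have "s \<notin> contraction \<qq>" if "s \<in> S" for s
  proof
    assume "s \<in> contraction \<qq>"
    then have "frac s s \<in> \<qq>"
      using frac_in_prime_iff[OF assms] that by (simp add: S_carrier)
    moreover have "frac s s = \<one>\<^bsub>loc\<^esub>"
      using frac_cancel[of \<one> \<one> s] that by (simp add: one_loc loc_simps)
    ultimately have "\<qq> = carrier loc"
      using \<qq>.one_imp_carrier by simp
    then show False
      using \<qq>.I_notcarr by simp
  qed
  then show "contraction \<qq> \<inter> S = {}"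
    by blast
qed

lemma extension_contraction:
  assumes "primeideal \<qq> loc"
  shows "extension (contraction \<qq>) = \<qq>"
proof -
  interpret \<qq>: primeideal \<qq> loc by fact
  have "extension (contraction \<qq>) = {frac a s | a s. a \<in> carrier R \<and> s \<in> S \<and> frac a s \<in> \<qq>}"
    using frac_in_prime_iff[OF assms] by (auto simp: extension_def contraction_def)
  also have "\<dots> = carrier loc \<inter> \<qq>"
    using carrier_loc by auto
  also have "\<dots> = \<qq>"
    using \<qq>.a_subset by blast
  finally show ?thesis .
qed

text \<open>A fraction has many numerators, and one in \<open>\<pp>\<close> has to force the others.
  In \<open>u \<otimes> (a \<otimes> t) = u \<otimes> (b \<otimes> s)\<close> with \<open>b\<close>
  in \<open>\<pp>\<close>, primality strips off \<open>u\<close> and \<open>t\<close>, which lie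
  outside \<open>\<pp>\<close> by disjointness.\<close>

lemma frac_in_extension_iff:
  assumes \<pp>: "primeideal \<pp> R" "\<pp> \<inter> S = {}" and a: "a \<in> carrier R" "s \<in> S"
  shows "frac a s \<in> extension \<pp> \<longleftrightarrow> a \<in> \<pp>"
proof
  interpret \<pp>: primeideal \<pp> R by fact
  assume "frac a s \<in> extension \<pp>"
  then obtain b t where b: "b \<in> \<pp>" "t \<in> S" "frac a s = frac b t"
    by (auto simp: extension_def)
  then have carr: "b \<in> carrier R"
    using \<pp>.a_subset by blast
  obtain u where u: "u \<in> S" "u \<otimes> (a \<otimes> t) = u \<otimes> (b \<otimes> s)"
    using b carr a by (auto simp: frac_eq_iff)
  have "u \<otimes> (a \<otimes> t) \<in> \<pp>"
    unfolding u using b u a by (simp add: \<pp>.I_l_closed \<pp>.I_r_closed S_carrier)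
  moreover have "u \<notin> \<pp>" "t \<notin> \<pp>"
    using \<pp> u b by auto
  ultimately show "a \<in> \<pp>"
    using \<pp>.I_prime[of u "a \<otimes> t"] \<pp>.I_prime[of a t] a b u by (simp add: S_carrier)
next
  assume "a \<in> \<pp>"
  then show "frac a s \<in> extension \<pp>"
    using a by (auto simp: extension_def)
qed

text \<open>Membership in the extension can be tested on any numerator, so closure and primality are
  inherited from \<open>\<pp>\<close>.\<close>

lemma extension_prime:
  assumes \<pp>: "primeideal \<pp> R" "\<pp> \<inter> S = {}"
  shows "primeideal (extension \<pp>) loc" and "contraction (extension \<pp>) = \<pp>"
proof -
  interpret \<pp>: primeideal \<pp> R by fact
  have carr: "a \<in> carrier R" if "a \<in> \<pp>" for a
    using that \<pp>.a_subset by blast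
  note iff = frac_in_extension_iff[OF \<pp>]
  have sub: "extension \<pp> \<subseteq> carrier loc"
    using carr by (auto simp: extension_def loc_simps)
  have closed: "x \<otimes>\<^bsub>loc\<^esub> y \<in> extension \<pp>" if "x \<in> carrier loc" "y \<in> extension \<pp>" for x y
  proof -
    obtain a s where "a \<in> carrier R" "s \<in> S" "x = frac a s"
      using \<open>x \<in> carrier loc\<close> by (rule loc_cases)
    moreover obtain b t where "b \<in> \<pp>" "t \<in> S" "y = frac b t"
      using \<open>y \<in> extension \<pp>\<close> by (auto simp: extension_def)
    ultimately show ?thesis
      using carr by (simp add: loc_simps iff \<pp>.I_l_closed)
  qed
  have "ideal (extension \<pp>) loc"
  proof (rule idealI)
    show "subgroup (extension \<pp>) (add_monoid loc)"
    proof (rule loc.add.subgroupI)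
      show "extension \<pp> \<noteq> {}"
        using iff[of \<zero> \<one>] one_in_S by auto
      fix x
      assume "x \<in> extension \<pp>"
      \<comment> \<open>Negation is handled as multiplication by \<open>-1\<close>, which reduces it
        to \<open>closed\<close>.\<close>
      then have "(\<ominus>\<^bsub>loc\<^esub> \<one>\<^bsub>loc\<^esub>) \<otimes>\<^bsub>loc\<^esub> x \<in> extension \<pp>"
        by (intro closed) auto
      then show "\<ominus>\<^bsub>loc\<^esub> x \<in> extension \<pp>"
        using sub \<open>x \<in> extension \<pp>\<close> by (simp add: loc.l_minus subset_iff)
    next
      fix x y
      assume "x \<in> extension \<pp>" "y \<in> extension \<pp>"
      then obtain a s b t where "a \<in> \<pp>" "s \<in> S" "x = frac a s" "b \<in> \<pp>" "t \<in> S" "y = frac b t"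
        by (auto simp: extension_def)
      then show "x \<oplus>\<^bsub>loc\<^esub> y \<in> extension \<pp>"
        using carr by (simp add: loc_simps iff \<pp>.I_r_closed \<pp>.a_closed)
    qed (use sub in simp_all)
  next
    fix x y
    assume "x \<in> extension \<pp>" "y \<in> carrier loc"
    then show "y \<otimes>\<^bsub>loc\<^esub> x \<in> extension \<pp>" "x \<otimes>\<^bsub>loc\<^esub> y \<in> extension \<pp>"
      using closed[of y x] loc.m_comm[of x y] sub by (simp_all add: subset_iff)
  qed (rule loc.ring_axioms)
  then show "primeideal (extension \<pp>) loc"
  proof (rule primeidealI[OF _ cring_loc])
    have "\<one> \<notin> \<pp>"
      using \<pp> one_in_S by blast
    then show "carrier loc \<noteq> extension \<pp>"
      using iff[of \<one> \<one>] frac_in_carrier[of \<one> \<one>] one_in_S by auto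
    fix x y
    assume "x \<in> carrier loc" "y \<in> carrier loc" "x \<otimes>\<^bsub>loc\<^esub> y \<in> extension \<pp>"
    then show "x \<in> extension \<pp> \<or> y \<in> extension \<pp>"
      by (elim loc_cases) (simp add: loc_simps iff \<pp>.I_prime)
  qed
  show "contraction (extension \<pp>) = \<pp>"
    using carr iff one_in_S by (auto simp: contraction_def)
qed

section \<open>Contraction as a homeomorphism onto its image\<close>

lemma bij_betw_contraction: "bij_betw contraction (Spec loc) {\<pp> \<in> Spec R. \<pp> \<inter> S = {}}"
proof (rule bij_betw_byWitness[of _ extension])
  show "\<forall>\<qq>\<in>Spec loc. extension (contraction \<qq>) = \<qq>"
    by (simp add: Spec_def extension_contraction)
  show "\<forall>\<pp>\<in>{\<pp> \<in> Spec R. \<pp> \<inter> S = {}}. contraction (extension \<pp>) = \<pp>"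
    by (simp add: Spec_def extension_prime)
  show "contraction ` Spec loc \<subseteq> {\<pp> \<in> Spec R. \<pp> \<inter> S = {}}"
    using contraction_prime unfolding Spec_def by blast
  show "extension ` {\<pp> \<in> Spec R. \<pp> \<inter> S = {}} \<subseteq> Spec loc"
    using extension_prime unfolding Spec_def by blast
qed

text \<open>A prime contains \<open>E\<close> exactly when its contraction contains every numerator
  of a fraction in \<open>E\<close>, so the closed set of \<open>E\<close> matches that of its
  numerators.\<close>

lemma contraction_basic_open:
  assumes "E \<subseteq> carrier loc"
  shows "contraction ` (Spec loc - {\<qq> \<in> Spec loc. E \<subseteq> \<qq>}) =
    (Spec R - {\<pp> \<in> Spec R. {a \<in> carrier R. \<exists>s\<in>S. frac a s \<in> E} \<subseteq> \<pp>}) \<inter> {\<pp> \<in> Spec R. \<pp> \<inter> S = {}}"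
    (is "?L = ?D")
proof -
  have "E \<subseteq> \<qq> \<longleftrightarrow> {a \<in> carrier R. \<exists>s\<in>S. frac a s \<in> E} \<subseteq> contraction \<qq>" if "\<qq> \<in> Spec loc" for \<qq>
  proof -
    have "primeideal \<qq> loc" using that by (simp add: Spec_def)
    note iff = frac_in_prime_iff[OF this]
    show ?thesis
    proof
      assume "E \<subseteq> \<qq>"
      then show "{a \<in> carrier R. \<exists>s\<in>S. frac a s \<in> E} \<subseteq> contraction \<qq>"
        using iff by blast
    next
      assume sub: "{a \<in> carrier R. \<exists>s\<in>S. frac a s \<in> E} \<subseteq> contraction \<qq>"
      show "E \<subseteq> \<qq>"
      proof
        fix x
        assume "x \<in> E"
        moreover from this obtain a s where "a \<in> carrier R" "s \<in> S" "x = frac a s"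
          using assms loc_cases by blast
        ultimately show "x \<in> \<qq>"
          using iff[of a s] sub by blast
      qed
    qed
  qed
  then have "Spec loc - {\<qq> \<in> Spec loc. E \<subseteq> \<qq>} =
      {\<qq> \<in> Spec loc. \<not> {a \<in> carrier R. \<exists>s\<in>S. frac a s \<in> E} \<subseteq> contraction \<qq>}"
    by blast
  then have "?L = {\<pp> \<in> contraction ` Spec loc. \<not> {a \<in> carrier R. \<exists>s\<in>S. frac a s \<in> E} \<subseteq> \<pp>}"
    by auto
  also have "contraction ` Spec loc = {\<pp> \<in> Spec R. \<pp> \<inter> S = {}}"
    using bij_betw_contraction by (simp add: bij_betw_def)
  also have "{\<pp> \<in> {\<pp> \<in> Spec R. \<pp> \<inter> S = {}}. \<not> {a \<in> carrier R. \<exists>s\<in>S. frac a s \<in> E} \<subseteq> \<pp>} = ?D"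
    by blast
  finally show ?thesis .
qed

text \<open>Images of open sets are open by passing to numerators; an open set of the subspace cut
  out by \<open>E\<close> is the image of the one cut out by the fractions \<open>a/1\<close> with
  \<open>a\<close> in \<open>E\<close>.\<close>

lemma bij_betw_contraction_opens:
  "bij_betw ((`) contraction) {W. openin (zariski loc) W}
    {Z. openin (subtopology (zariski R) {\<pp> \<in> Spec R. \<pp> \<inter> S = {}}) Z}"
proof (rule bij_betw_imageI)
  have "inj_on contraction (Spec loc)"
    using bij_betw_contraction by (simp add: bij_betw_def)
  then show "inj_on ((`) contraction) {W. openin (zariski loc) W}"
    by (intro inj_onI) (simp add: inj_on_image_eq_iff zariski_subset_Spec)
  let ?D = "{\<pp> \<in> Spec R. \<pp> \<inter> S = {}}"
  let ?num = "\<lambda>E. {a \<in> carrier R. \<exists>s\<in>S. frac a s \<in> E}"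
  show "(`) contraction ` {W. openin (zariski loc) W} = {Z. openin (subtopology (zariski R) ?D) Z}"
  proof (intro equalityI subsetI)
    fix Z
    assume "Z \<in> (`) contraction ` {W. openin (zariski loc) W}"
    then obtain E where "E \<subseteq> carrier loc" "Z = contraction ` (Spec loc - {\<qq> \<in> Spec loc. E \<subseteq> \<qq>})"
      by (auto simp: openin_zariski)
    then have "Z = (Spec R - {\<pp> \<in> Spec R. ?num E \<subseteq> \<pp>}) \<inter> ?D"
      by (simp only: contraction_basic_open)
    moreover have "openin (zariski R) (Spec R - {\<pp> \<in> Spec R. ?num E \<subseteq> \<pp>})"
      unfolding openin_zariski by (intro exI[of _ "?num E"]) auto
    ultimately show "Z \<in> {Z. openin (subtopology (zariski R) ?D) Z}"
      unfolding openin_subtopology by blast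
  next
    fix Z
    assume "Z \<in> {Z. openin (subtopology (zariski R) ?D) Z}"
    then obtain E where E: "E \<subseteq> carrier R" "Z = (Spec R - {\<pp> \<in> Spec R. E \<subseteq> \<pp>}) \<inter> ?D"
      by (auto simp: openin_subtopology openin_zariski)
    let ?E = "(\<lambda>a. frac a \<one>) ` E"
    have E': "?E \<subseteq> carrier loc"
      using E by (auto simp: loc_simps)
    \<comment> \<open>Other representatives may make \<open>?num ?E\<close> larger than
      \<open>E\<close>, but a prime disjoint from \<open>S\<close> does not see the
      difference.\<close>
    have "?num ?E \<subseteq> \<pp> \<longleftrightarrow> E \<subseteq> \<pp>" if "\<pp> \<in> ?D" for \<pp>
    proof
      assume "?num ?E \<subseteq> \<pp>"
      then show "E \<subseteq> \<pp>"
        using E one_in_S by blast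
    next
      assume "E \<subseteq> \<pp>"
      moreover have "primeideal \<pp> R" "\<pp> \<inter> S = {}"
        using that by (auto simp: Spec_def)
      note iff = frac_in_extension_iff[OF this]
      ultimately have "?E \<subseteq> extension \<pp>"
        using E iff one_in_S by blast
      then show "?num ?E \<subseteq> \<pp>"
        using iff by blast
    qed
    then have "Z = (Spec R - {\<pp> \<in> Spec R. ?num ?E \<subseteq> \<pp>}) \<inter> ?D"
      using E by blast
    then have "Z = contraction ` (Spec loc - {\<qq> \<in> Spec loc. ?E \<subseteq> \<qq>})"
      using contraction_basic_open[OF E'] by simp
    moreover have "openin (zariski loc) (Spec loc - {\<qq> \<in> Spec loc. ?E \<subseteq> \<qq>})"
      using E' unfolding openin_zariski by blast
    ultimately show "Z \<in> (`) contraction ` {W. openin (zariski loc) W}"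
      by blast
  qed
qed

lemma contraction_subset_iff:
  assumes "openin (zariski loc) V" "openin (zariski loc) W"
  shows "contraction ` V \<subseteq> contraction ` W \<longleftrightarrow> V \<subseteq> W"
  using assms bij_betw_contraction zariski_subset_Spec
  by (intro inj_on_image_subset_iff[of _ "Spec loc"]) (auto simp: bij_betw_def)

end

section \<open>Specialisation to the complement of a prime ideal\<close>

lemma (in primeideal) multiplicative_set_complement: "multiplicative_set R (carrier R - I)"
proof
  show "\<one> \<in> carrier R - I"
    using one_imp_carrier I_notcarr by auto
  show "s \<otimes> t \<in> carrier R - I" if "s \<in> carrier R - I" "t \<in> carrier R - I" for s t
    using that I_prime by auto
qed auto

lemma primes_below_eq: "primes_below R \<pp> = {\<qq> \<in> Spec R. \<qq> \<inter> (carrier R - \<pp>) = {}}"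
  unfolding primes_below_def
proof (intro Collect_cong conj_cong refl)
  fix \<qq>
  assume "\<qq> \<in> Spec R"
  then interpret primeideal \<qq> R
    by (simp add: Spec_def)
  show "\<qq> \<subseteq> \<pp> \<longleftrightarrow> \<qq> \<inter> (carrier R - \<pp>) = {}"
    using a_subset by blast
qed

theorem theorem3:
  shows
    "(\<forall>(X :: 'a topology) Y s. Y \<subseteq> topspace X \<and> pixel_choice X Y s \<longrightarrow>
        (\<exists>F. category_iso (top_cat (subtopology X Y)) (pixel_quiver_cat X Y s) (pixel X Y) F))
   \<and> (\<forall>(R :: ('b, 'c) ring_scheme) \<pp> s.
        cring R \<and> primeideal \<pp> R \<and> pixel_choice (zariski R) (primes_below R \<pp>) s \<longrightarrow>
        (\<exists>F. category_iso (top_cat (zariski (localization_at R \<pp>)))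
               (pixel_quiver_cat (zariski R) (primes_below R \<pp>) s)
               (\<lambda>W. pixel (zariski R) (primes_below R \<pp>) (contraction_at R \<pp> ` W)) F))"
proof (intro conjI allI impI)
  fix X :: "'a topology" and Y s
  assume "Y \<subseteq> topspace X \<and> pixel_choice X Y s"
  \<comment> \<open>Here \<open>h\<close> is the identity on the open sets of the subspace.\<close>
  then show "\<exists>F. category_iso (top_cat (subtopology X Y)) (pixel_quiver_cat X Y s) (pixel X Y) F"
    using pixel_quiver_cat_iso[of X Y s "\<lambda>W. W" "subtopology X Y"] by (simp add: bij_betw_def)
next
  fix R :: "('b, 'c) ring_scheme" and \<pp> s
  assume asm: "cring R \<and> primeideal \<pp> R \<and> pixel_choice (zariski R) (primes_below R \<pp>) s"
  then interpret multiplicative_set R "carrier R - \<pp>"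
    by (intro primeideal.multiplicative_set_complement) simp
  \<comment> \<open>With \<open>S\<close> the complement of \<open>\<pp>\<close>, both maps test
    whether \<open>a/1\<close> lies in the given prime.\<close>
  have "contraction = contraction_at R \<pp>"
    by (simp add: fun_eq_iff contraction_def contraction_at_def frac_def)
  then show "\<exists>F. category_iso (top_cat (zariski (localization_at R \<pp>)))
      (pixel_quiver_cat (zariski R) (primes_below R \<pp>) s)
      (\<lambda>W. pixel (zariski R) (primes_below R \<pp>) (contraction_at R \<pp> ` W)) F"
    using pixel_quiver_cat_iso[of "zariski R" "primes_below R \<pp>" s "(`) contraction" "zariski loc"]
      bij_betw_contraction_opens contraction_subset_iff asm
    by (simp add: primes_below_eq localization_at_def)
qed

end
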